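(* Let $k$ be a field, $R$ a $k$-algebra, and let $$A=R[x_1;\tau_1,\delta_1]\cdots[x_n;\tau_n,\delta_n][y;\sigma],\qquad \widehat A=R[x_1;\tau_1,\delta_1]\cdots[x_n;\tau_n,\delta_n][y^{\pm1};\sigma],$$ where $\sigma(R)=R$ and, for all $i\in\{1,\dots,n\}$, $\sigma(x_i)=\lambda_ix_i$ for some nonzero $\lambda_i\in k$. Let $A_j=R[x_1;\tau_1,\delta_1]\cdots[x_j;\tau_j,\delta_j]$ for $j=1,\dots,n$, and $A_0=R$. (1) Then $$A=R[y;\sigma^*][x_1;\tau_1',\delta_1']\cdots[x_n;\tau_n',\delta_n'],\qquad\widehat A=R[y^{\pm1};\sigma^*][x_1;\tau_1',\delta_1']\cdots[x_n;\tau_n',\delta_n'],$$ where $\sigma^*=\sigma|_R$, $\tau_i'|_{A_j}=\tau_i|_{A_j}$, $\delta_i'|_{A_j}=\delta_i|_{A_j}$, $\tau_i'(y)=\lambda_i^{-1}y$, and $\delta_i'(y)=0$ for all $1\le i\le n$ and $j\le i-1$. (2) If $(\tau_i,\delta_i)$ is $q_i$-skew for any $1\le i\le n$, then $(\tau_i',\delta_i')$ is also $q_i$-skew. (3) Suppose that each $\delta_i$ extends to a higher $q_i$-skew $\tau_i$-derivation $\{d_{i,p}\}_{p=0}^\infty$ (on $A_{i-1}$), and that $\sigma d_{i,p}=\lambda_i^pd_{i,p}\sigma$ on $A_{i-1}$ for all $i$ and $p$. Then each $\delta_i'$ extends to a higher $q_i$-skew $\tau_i'$-derivation $\{d_{i,p}'\}_{p=0}^\infty$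 on the algebra $R\langle y,y^{-1},x_1,\dots,x_{i-1}\rangle$, where $d_{i,p}'$ coincides with $d_{i,p}$ on $A_j$ for $j<i$, and $d_{i,p}'(y)=0$ for $p\ge1$. Moreover, $\{d_{i,p}'\}$ restricts to a higher $q_i$-skew $\tau_i'$-derivation on $R\langle y,x_1,\dots,x_{i-1}\rangle$. Further: (a) if $\{d_{i,p}\}$ is iterative for any $1\le i\le n$, then $\{d_{i,p}'\}$ is iterative; (b) if $\{d_{i,p}\}$ is locally nilpotent for any $1\le i\le n$, then $\{d_{i,p}'\}$ is locally nilpotent.
   Context: Conventions: in a skew polynomial ring $R[x;\tau,\delta]$, $R$ is a $k$-algebra, $\tau$ is a $k$-algebra automorphism of $R$, $\delta$ is a $k$-linear $\tau$-derivation ($\delta(rs)=\tau(r)\delta(s)+\delta(r)s$), and $xr=\tau(r)x+\delta(r)$; $R[y;\sigma]$ means zero derivation and $R[y^{\pm1};\sigma]$ is the skew Laurent ring. $(\tau,\delta)$ is $q$-skew (for $q\in k^\times$) if $\delta\tau=q\tau\delta$. $R\langle\dots\rangle$ denotes the subalgebra of $\widehat A$ generated by $R$ and the listed elements. For an indeterminate $t$: $(m)_t=t^{m-1}+\cdots+t+1$, $(m)!_t=(m)_t\cdots(1)_t$, $(0)!_t=1$, $\binom{n}{m}_t=\frac{(n)!_t}{(m)!_t(n-m)!_t}$ (a polynomial in $t$), and $\binom{n}{m}_q$ is its value at $t=q$. A higher $q$-skew $\tau$-derivation on a $k$-algebra $R$ is a sequence $d_0,d_1,d_2,\dots$ of $k$-linear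 operators on $R$ with $d_0=\mathrm{id}$, $d_n(rs)=\sum_{i=0}^n\tau^{n-i}d_i(r)\,d_{n-i}(s)$ for all $r,s\in R$ and all $n$, and $d_i\tau=q^i\tau d_i$ for all $i$. It is locally nilpotent if for every $r\in R$ there is $n\ge0$ with $d_i(r)=0$ for all $i\ge n$. It is iterative if $d_id_j=\binom{i+j}{j}_qd_{i+j}$ for all $i,j$. $\delta$ extends to $\{d_i\}$ if $d_1=\delta$. *)

theory Defs
  imports Complex_Main "HOL-Computational_Algebra.Polynomial"
begin

(* The sort {ring, monoid_mult} is that of associative unital rings; unlike ring_1 it does
   not exclude the zero ring. *)
locale k_algebra = vector_space scale
  for scale :: "'k::field \<Rightarrow> 'a::{ring,monoid_mult} \<Rightarrow> 'a" +
  assumes scale_mult_left: "scale c (a * b) = scale c a * b"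
    and scale_mult_right: "scale c (a * b) = a * scale c b"

(* Closure under 0 and negation follows from closure under scale. *)
definition subalgebra :: "('k::field \<Rightarrow> 'a::{ring,monoid_mult} \<Rightarrow> 'a) \<Rightarrow> 'a set \<Rightarrow> bool" where
  "subalgebra scale B \<longleftrightarrow>
     1 \<in> B \<and> (\<forall>a\<in>B. \<forall>b\<in>B. a + b \<in> B \<and> a * b \<in> B) \<and> (\<forall>c. \<forall>a\<in>B. scale c a \<in> B)"

(* Operators on a subalgebra B are total functions on the ambient algebra; only their values
   on B matter. *)

definition linear_operator_on ::
    "('k::field \<Rightarrow> 'a::{ring,monoid_mult} \<Rightarrow> 'a) \<Rightarrow> 'a set \<Rightarrow> ('a \<Rightarrow> 'a) \<Rightarrow> bool" where
  "linear_operator_on scale B f \<longleftrightarrow>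
     f ` B \<subseteq> B \<and> (\<forall>a\<in>B. \<forall>b\<in>B. f (a + b) = f a + f b) \<and>
     (\<forall>c. \<forall>a\<in>B. f (scale c a) = scale c (f a))"

definition algebra_automorphism_on ::
    "('k::field \<Rightarrow> 'a::{ring,monoid_mult} \<Rightarrow> 'a) \<Rightarrow> 'a set \<Rightarrow> ('a \<Rightarrow> 'a) \<Rightarrow> bool" where
  "algebra_automorphism_on scale B \<tau> \<longleftrightarrow>
     linear_operator_on scale B \<tau> \<and> bij_betw \<tau> B B \<and> \<tau> 1 = 1 \<and>
     (\<forall>a\<in>B. \<forall>b\<in>B. \<tau> (a * b) = \<tau> a * \<tau> b)"

definition skew_derivation_on ::
    "('k::field \<Rightarrow> 'a::{ring,monoid_mult} \<Rightarrow> 'a) \<Rightarrow> 'a set \<Rightarrow> ('a \<Rightarrow> 'a) \<Rightarrow> ('a \<Rightarrow> 'a) \<Rightarrow> bool" where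
  "skew_derivation_on scale B \<tau> \<delta> \<longleftrightarrow>
     linear_operator_on scale B \<delta> \<and>
     (\<forall>r\<in>B. \<forall>s\<in>B. \<delta> (r * s) = \<tau> r * \<delta> s + \<delta> r * s)"

(* S = B[x; \<tau>, \<delta>], for B and S inside one ambient algebra: S contains B and x, satisfies the
   commutation relation, and is a free left B-module on the powers of x. *)
definition skew_poly_ring ::
    "('k::field \<Rightarrow> 'a::{ring,monoid_mult} \<Rightarrow> 'a) \<Rightarrow> 'a set \<Rightarrow> 'a \<Rightarrow> ('a \<Rightarrow> 'a) \<Rightarrow> ('a \<Rightarrow> 'a)
      \<Rightarrow> 'a set \<Rightarrow> bool" where
  "skew_poly_ring scale B x \<tau> \<delta> S \<longleftrightarrow>
     subalgebra scale B \<and> algebra_automorphism_on scale B \<tau> \<and> skew_derivation_on scale B \<tau> \<delta> \<and>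
     subalgebra scale S \<and> B \<subseteq> S \<and> x \<in> S \<and>
     (\<forall>r\<in>B. x * r = \<tau> r * x + \<delta> r) \<and>
     (\<forall>s\<in>S. \<exists>!c :: nat \<Rightarrow> 'a. range c \<subseteq> B \<and> finite {m. c m \<noteq> 0} \<and>
        s = (\<Sum>m | c m \<noteq> 0. c m * x ^ m))"

(* y to the power m, with yi the inverse of y. *)
definition unit_power :: "'a::monoid_mult \<Rightarrow> 'a \<Rightarrow> int \<Rightarrow> 'a" where
  "unit_power y yi m = (if m \<ge> 0 then y ^ nat m else yi ^ nat (- m))"

(* S = B[y, yi; \<sigma>], the skew Laurent ring, where yi is the inverse of y. *)
definition skew_laurent_ring ::
    "('k::field \<Rightarrow> 'a::{ring,monoid_mult} \<Rightarrow> 'a) \<Rightarrow> 'a set \<Rightarrow> 'a \<Rightarrow> 'a \<Rightarrow> ('a \<Rightarrow> 'a)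
      \<Rightarrow> 'a set \<Rightarrow> bool" where
  "skew_laurent_ring scale B y yi \<sigma> S \<longleftrightarrow>
     subalgebra scale B \<and> algebra_automorphism_on scale B \<sigma> \<and>
     subalgebra scale S \<and> B \<subseteq> S \<and> y \<in> S \<and> yi \<in> S \<and> y * yi = 1 \<and> yi * y = 1 \<and>
     (\<forall>r\<in>B. y * r = \<sigma> r * y) \<and>
     (\<forall>s\<in>S. \<exists>!c :: int \<Rightarrow> 'a. range c \<subseteq> B \<and> finite {m. c m \<noteq> 0} \<and>
        s = (\<Sum>m | c m \<noteq> 0. c m * unit_power y yi m))"

(* S j = B[x 1; \<tau> 1, \<delta> 1]...[x j; \<tau> j, \<delta> j] for j = 0, ..., n. *)
definition iterated_skew_poly_ring ::
    "('k::field \<Rightarrow> 'a::{ring,monoid_mult} \<Rightarrow> 'a) \<Rightarrow> 'a set \<Rightarrow> nat \<Rightarrow> (nat \<Rightarrow> 'a)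
      \<Rightarrow> (nat \<Rightarrow> 'a \<Rightarrow> 'a) \<Rightarrow> (nat \<Rightarrow> 'a \<Rightarrow> 'a) \<Rightarrow> (nat \<Rightarrow> 'a set) \<Rightarrow> bool" where
  "iterated_skew_poly_ring scale B n x \<tau> \<delta> S \<longleftrightarrow>
     subalgebra scale B \<and> S 0 = B \<and>
     (\<forall>i\<in>{1..n}. skew_poly_ring scale (S (i - 1)) (x i) (\<tau> i) (\<delta> i) (S i))"

definition q_skew_on ::
    "('k::field \<Rightarrow> 'a::{ring,monoid_mult} \<Rightarrow> 'a) \<Rightarrow> 'a set \<Rightarrow> 'k \<Rightarrow> ('a \<Rightarrow> 'a) \<Rightarrow> ('a \<Rightarrow> 'a) \<Rightarrow> bool"
  where
  "q_skew_on scale B q \<tau> \<delta> \<longleftrightarrow> q \<noteq> 0 \<and> (\<forall>r\<in>B. \<delta> (\<tau> r) = scale q (\<tau> (\<delta> r)))"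

(* The indeterminate t lives in k[t]; the quotient defining the Gaussian binomial is exact
   for m \<le> n. *)
definition t_number :: "nat \<Rightarrow> 'k::field poly" where
  "t_number m = (\<Sum>i<m. monom 1 i)"

definition t_fact :: "nat \<Rightarrow> 'k::field poly" where
  "t_fact m = (\<Prod>i=1..m. t_number i)"

definition q_binomial :: "nat \<Rightarrow> nat \<Rightarrow> 'k::field \<Rightarrow> 'k" where
  "q_binomial n m q = poly (t_fact n div (t_fact m * t_fact (n - m))) q"

definition higher_skew_derivation_on ::
    "('k::field \<Rightarrow> 'a::{ring,monoid_mult} \<Rightarrow> 'a) \<Rightarrow> 'a set \<Rightarrow> 'k \<Rightarrow> ('a \<Rightarrow> 'a) \<Rightarrow> (nat \<Rightarrow> 'a \<Rightarrow> 'a)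
      \<Rightarrow> bool" where
  "higher_skew_derivation_on scale B q \<tau> d \<longleftrightarrow>
     q \<noteq> 0 \<and> (\<forall>p. linear_operator_on scale B (d p)) \<and> (\<forall>r\<in>B. d 0 r = r) \<and>
     (\<forall>p. \<forall>r\<in>B. \<forall>s\<in>B. d p (r * s) = (\<Sum>i=0..p. (\<tau> ^^ (p - i)) (d i r) * d (p - i) s)) \<and>
     (\<forall>p. \<forall>r\<in>B. d p (\<tau> r) = scale (q ^ p) (\<tau> (d p r)))"

definition extends_to_on :: "'a set \<Rightarrow> ('a \<Rightarrow> 'a) \<Rightarrow> (nat \<Rightarrow> 'a \<Rightarrow> 'a) \<Rightarrow> bool" where
  "extends_to_on B \<delta> d \<longleftrightarrow> (\<forall>r\<in>B. d 1 r = \<delta> r)"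

definition locally_nilpotent_on :: "'a::zero set \<Rightarrow> (nat \<Rightarrow> 'a \<Rightarrow> 'a) \<Rightarrow> bool" where
  "locally_nilpotent_on B d \<longleftrightarrow> (\<forall>r\<in>B. \<exists>m. \<forall>i\<ge>m. d i r = 0)"

definition iterative_on ::
    "('k::field \<Rightarrow> 'a::{ring,monoid_mult} \<Rightarrow> 'a) \<Rightarrow> 'a set \<Rightarrow> 'k \<Rightarrow> (nat \<Rightarrow> 'a \<Rightarrow> 'a) \<Rightarrow> bool" where
  "iterative_on scale B q d \<longleftrightarrow>
     (\<forall>i j. \<forall>r\<in>B. d i (d j r) = scale (q_binomial (i + j) j q) (d (i + j) r))"

end

(* Every element of Ahat is uniquely a sum of monomials a y^m with a in A_n.  Since sigma preserves
   each A_j, the elements with coefficients in A_j form a subalgebra, which is the one generated by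
   R, y, y^-1, x_1, ..., x_j; asking for nonnegative exponents removes the generator y^-1.
   Applying sigma to x_i a = tau_i(a) x_i + delta_i(a) gives sigma tau_i = tau_i sigma and
   sigma delta_i = lambda_i delta_i sigma.  So the maps
     tau_i'(a y^m) = lambda_i^-m tau_i(a) y^m,  delta_i'(a y^m) = delta_i(a) y^m,
     d_{i,p}'(a y^m) = d_{i,p}(a) y^m
   obey the required product rules on monomials, and the expansions in powers of x_i with
   coefficients in A_{i-1} can be regrouped, because x_i y = lambda_i^-1 y x_i. *)
theory Submission
  imports Defs
begin

text \<open>The factor \<lambda>_i^-m in \<tau>_i' is forced by the product rule. The coefficient of
  \<delta>_i'((a y^m)(b y^l)) is \<delta>_i(a \<sigma>^m(b)), whose first term is \<tau>_i(a)
  \<delta>_i(\<sigma>^m(b)) = \<lambda>_i^-m \<tau>_i(a) \<sigma>^m(\<delta>_i(b)); this is the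
  coefficient of \<tau>_i'(a y^m) \<delta>_i'(b y^l) once \<tau>_i' carries that scalar. In the
  higher rule the term containing d_{i,j}(\<sigma>^m(b)) produces \<lambda>_i^-mj, matched by the
  j-th power of \<tau>_i'; this is why the compatibility of d_{i,p} with \<sigma> is assumed with
  the p-th power of \<lambda>_i. Two points shape the formalization. Negative m needs negative
  powers of \<sigma>, which is only given as a map on A_n; conjugation by y^m replaces \<sigma>^m.
  And one pair of maps must serve the polynomial and the Laurent ring at once: the maps are defined
  through Laurent coefficients alone, and all statements are proved for an arbitrary set M of
  exponents that contains 0 and is closed under addition.\<close>

lemma linear_operator_on_D:
  assumes "linear_operator_on scale B f"
  shows "a \<in> B \<Longrightarrow> f a \<in> B"
    and "a \<in> B \<Longrightarrow> b \<in> B \<Longrightarrow> f (a + b) = f a + f b"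
    and "a \<in> B \<Longrightarrow> f (scale c a) = scale c (f a)"
  using assms unfolding linear_operator_on_def by blast+

lemma linear_operator_on_funpow:
  assumes "linear_operator_on scale B f"
  shows "linear_operator_on scale B (f ^^ p)"
proof (induction p)
  case 0
  show ?case by (simp add: linear_operator_on_def)
next
  case (Suc p)
  show ?case
    unfolding linear_operator_on_def
    by (auto simp: linear_operator_on_D[OF assms] linear_operator_on_D[OF Suc.IH])
qed

lemma automorphism_onD:
  assumes "algebra_automorphism_on scale B \<tau>"
  shows "linear_operator_on scale B \<tau>" and "bij_betw \<tau> B B" and "\<tau> 1 = 1"
    and "a \<in> B \<Longrightarrow> b \<in> B \<Longrightarrow> \<tau> (a * b) = \<tau> a * \<tau> b"
  using assms unfolding algebra_automorphism_on_def by blast+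

lemma sum_support:
  fixes c :: "'i \<Rightarrow> 'a::ring"
  assumes "finite F" and "\<And>m. m \<notin> F \<Longrightarrow> c m = 0"
  shows "(\<Sum>m | c m \<noteq> 0. c m * e m) = (\<Sum>m\<in>F. c m * e m)"
  by (rule sum.mono_neutral_left) (use assms in auto)

text \<open>The defining expansions sum over the support of each coefficient function, so two of
  them range over different sets. Padding both to a common finite \<open>F\<close> makes them
  comparable.\<close>

lemma unique_coefficients:
  fixes c d :: "'i \<Rightarrow> 'a::ring"
  assumes free: "\<forall>s\<in>S. \<exists>!c. range c \<subseteq> B \<and> finite {m. c m \<noteq> 0} \<and> s = (\<Sum>m | c m \<noteq> 0. c m * e m)"
    and "finite F" and "\<And>m. c m \<in> B" and "\<And>m. d m \<in> B"
    and cF: "\<And>m. m \<notin> F \<Longrightarrow> c m = 0" and dF: "\<And>m. m \<notin> F \<Longrightarrow> d m = 0"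
    and S: "(\<Sum>m\<in>F. c m * e m) \<in> S"
    and eq: "(\<Sum>m\<in>F. c m * e m) = (\<Sum>m\<in>F. d m * e m)"
  shows "c = d"
proof -
  let ?P = "\<lambda>c'. range c' \<subseteq> B \<and> finite {m. c' m \<noteq> 0} \<and>
      (\<Sum>m\<in>F. c m * e m) = (\<Sum>m | c' m \<noteq> 0. c' m * e m)"
  have "?P c"
    using assms(3) finite_subset[OF _ \<open>finite F\<close>, of "{m. c m \<noteq> 0}"] cF
      sum_support[OF \<open>finite F\<close> cF, where e = e] by auto
  moreover have "?P d"
    using assms(4) finite_subset[OF _ \<open>finite F\<close>, of "{m. d m \<noteq> 0}"] dF
      sum_support[OF \<open>finite F\<close> dF, where e = e] eq by auto
  moreover have "\<exists>!c'. ?P c'"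
    using free S by blast
  ultimately show ?thesis by blast
qed

text \<open>Counterpart for establishing freeness: existence and uniqueness may be shown with any
  finite \<open>F\<close> containing the supports, and the passage to exact supports is done once
  here.\<close>

lemma ex1_coefficientsI:
  fixes e :: "'i \<Rightarrow> 'a::ring"
  assumes ex: "\<exists>F c. finite F \<and> (\<forall>m. c m \<in> B) \<and> (\<forall>m. m \<notin> F \<longrightarrow> c m = 0) \<and> s = (\<Sum>m\<in>F. c m * e m)"
    and uniq: "\<And>F c d. finite F \<Longrightarrow> (\<And>m. c m \<in> B) \<Longrightarrow> (\<And>m. d m \<in> B) \<Longrightarrow>
      (\<And>m. m \<notin> F \<Longrightarrow> c m = 0) \<Longrightarrow> (\<And>m. m \<notin> F \<Longrightarrow> d m = 0) \<Longrightarrow>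
      s = (\<Sum>m\<in>F. c m * e m) \<Longrightarrow> s = (\<Sum>m\<in>F. d m * e m) \<Longrightarrow> c = d"
  shows "\<exists>!c. range c \<subseteq> B \<and> finite {m. c m \<noteq> 0} \<and> s = (\<Sum>m | c m \<noteq> 0. c m * e m)"
proof (rule ex_ex1I)
  obtain F c where c: "finite F" "\<And>m. c m \<in> B" "\<And>m. m \<notin> F \<Longrightarrow> c m = 0" "s = (\<Sum>m\<in>F. c m * e m)"
    using ex by blast
  have "finite {m. c m \<noteq> 0}" by (rule finite_subset[OF _ c(1)]) (use c in auto)
  moreover have "s = (\<Sum>m | c m \<noteq> 0. c m * e m)"
    using sum_support[OF c(1,3), where e = e] c(4) by simp
  ultimately show "\<exists>c. range c \<subseteq> B \<and> finite {m. c m \<noteq> 0} \<and> s = (\<Sum>m | c m \<noteq> 0. c m * e m)"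
    using c(2) by blast
next
  fix c d
  assume c: "range c \<subseteq> B \<and> finite {m. c m \<noteq> 0} \<and> s = (\<Sum>m | c m \<noteq> 0. c m * e m)"
    and d: "range d \<subseteq> B \<and> finite {m. d m \<noteq> 0} \<and> s = (\<Sum>m | d m \<noteq> 0. d m * e m)"
  let ?F = "{m. c m \<noteq> 0} \<union> {m. d m \<noteq> 0}"
  have fin: "finite ?F" using c d by simp
  show "c = d"
  proof (rule uniq[OF fin])
    show "s = (\<Sum>m\<in>?F. c m * e m)" using c sum_support[OF fin, of c e] by auto
    show "s = (\<Sum>m\<in>?F. d m * e m)" using d sum_support[OF fin, of d e] by auto
  qed (use c d in auto)
qed

lemma funpow_fixpoint:
  fixes f :: "'c \<Rightarrow> 'c"
  shows "f a = a \<Longrightarrow> (f ^^ p) a = a"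
  by (induction p) auto

section \<open>Subalgebras, skew polynomial rings and their iterations\<close>

context k_algebra
begin

lemma subalgebraD:
  assumes "subalgebra scale B"
  shows "1 \<in> B" and "a \<in> B \<Longrightarrow> b \<in> B \<Longrightarrow> a + b \<in> B" and "a \<in> B \<Longrightarrow> b \<in> B \<Longrightarrow> a * b \<in> B"
    and "a \<in> B \<Longrightarrow> scale c a \<in> B" and "0 \<in> B"
proof -
  show one: "1 \<in> B"
    using assms unfolding subalgebra_def by blast
  show "a \<in> B \<Longrightarrow> b \<in> B \<Longrightarrow> a + b \<in> B" "a \<in> B \<Longrightarrow> b \<in> B \<Longrightarrow> a * b \<in> B" "a \<in> B \<Longrightarrow> scale c a \<in> B"
    using assms unfolding subalgebra_def by blast+
  have "scale 0 1 \<in> B"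
    using assms one unfolding subalgebra_def by blast
  then show "0 \<in> B" by simp
qed

lemma subalgebra_sum:
  assumes "subalgebra scale B" "\<And>i. i \<in> I \<Longrightarrow> f i \<in> B"
  shows "sum f I \<in> B"
  using assms(2) by (induction I rule: infinite_finite_induct) (auto intro: subalgebraD[OF assms(1)])

lemma subalgebra_power:
  assumes "subalgebra scale B" "a \<in> B"
  shows "a ^ m \<in> B"
  by (induction m) (auto intro: subalgebraD[OF assms(1)] assms(2))

lemma linear_operator_on_zero:
  assumes "linear_operator_on scale B f" "subalgebra scale B"
  shows "f 0 = 0"
  using linear_operator_on_D(3)[OF assms(1) subalgebraD(1)[OF assms(2)], of 0] by simp

lemma linear_operator_on_scale:
  assumes "subalgebra scale B" "linear_operator_on scale B f"
  shows "linear_operator_on scale B (\<lambda>a. scale c (f a))"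
  unfolding linear_operator_on_def
  by (auto simp: linear_operator_on_D[OF assms(2)] scale_right_distrib mult.commute
      intro!: subalgebraD[OF assms(1)])

lemma subalgebra_linear_image:
  assumes "subalgebra scale B" "D \<subseteq> B" "algebra_automorphism_on scale B \<sigma>" "subalgebra scale D"
  shows "subalgebra scale (\<sigma> ` D)"
  unfolding subalgebra_def
proof (intro conjI ballI allI)
  note \<sigma> = automorphism_onD[OF assms(3)] linear_operator_on_D[OF automorphism_onD(1)[OF assms(3)]]
  note D = subalgebraD[OF assms(4)]
  show "1 \<in> \<sigma> ` D" using \<sigma>(3) D(1) by (metis imageI)
  fix u v c assume uv: "u \<in> \<sigma> ` D" "v \<in> \<sigma> ` D"
  then obtain a b where ab: "a \<in> D" "b \<in> D" "u = \<sigma> a" "v = \<sigma> b" by auto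
  then have "a \<in> B" "b \<in> B" using assms(2) by auto
  then have eq: "u + v = \<sigma> (a + b)" "u * v = \<sigma> (a * b)"
    by (simp_all add: ab \<sigma>)
  show "u + v \<in> \<sigma> ` D" "u * v \<in> \<sigma> ` D"
    unfolding eq using ab D by blast+
next
  note \<sigma> = linear_operator_on_D[OF automorphism_onD(1)[OF assms(3)]]
  fix c u assume "u \<in> \<sigma> ` D"
  then obtain a where a: "a \<in> D" "u = \<sigma> a" by auto
  then have "scale c u = \<sigma> (scale c a)" using assms(2) \<sigma>(3)[of a c] by auto
  then show "scale c u \<in> \<sigma> ` D" using a subalgebraD(4)[OF assms(4)] by blast
qed

lemma subalgebra_vimage:
  assumes "subalgebra scale B" "algebra_automorphism_on scale B \<sigma>" "subalgebra scale D"
  shows "subalgebra scale {a \<in> B. \<sigma> a \<in> D}"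
  unfolding subalgebra_def
  by (auto simp: automorphism_onD[OF assms(2)] linear_operator_on_D[OF automorphism_onD(1)[OF assms(2)]]
      subalgebraD[OF assms(1)] subalgebraD[OF assms(3)])

lemma skew_poly_ringD:
  assumes "skew_poly_ring scale B x \<tau> \<delta> S"
  shows "subalgebra scale B" "algebra_automorphism_on scale B \<tau>" "skew_derivation_on scale B \<tau> \<delta>"
    "subalgebra scale S" "B \<subseteq> S" "x \<in> S" "r \<in> B \<Longrightarrow> x * r = \<tau> r * x + \<delta> r"
    "\<forall>s\<in>S. \<exists>!c :: nat \<Rightarrow> 'a. range c \<subseteq> B \<and> finite {m. c m \<noteq> 0} \<and>
        s = (\<Sum>m | c m \<noteq> 0. c m * x ^ m)"
  using assms unfolding skew_poly_ring_def by blast+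

text \<open>Existence of expansions alone gives this; it is what identifies rings described by
  freeness with subalgebras described by generators.\<close>

lemma skew_poly_ring_minimal:
  assumes "skew_poly_ring scale B x \<tau> \<delta> S" "subalgebra scale D" "B \<subseteq> D" "x \<in> D"
  shows "S \<subseteq> D"
proof
  fix s assume "s \<in> S"
  then obtain c :: "nat \<Rightarrow> 'a" where "range c \<subseteq> B" "s = (\<Sum>m | c m \<noteq> 0. c m * x ^ m)"
    using skew_poly_ringD(8)[OF assms(1)] by blast
  then show "s \<in> D"
    using assms(3,4) by (auto intro!: subalgebra_sum subalgebraD(3) subalgebra_power assms(2))
qed

text \<open>Degree at most one suffices for comparing two forms of the commutation relation
  \<open>x * r = \<tau> r * x + \<delta> r\<close>.\<close>

lemma skew_poly_ring_linear_unique: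
  assumes S: "skew_poly_ring scale B x \<tau> \<delta> S"
    and "a \<in> B" "b \<in> B" "a' \<in> B" "b' \<in> B" "a * x + b = a' * x + b'"
  shows "a = a'" "b = b'"
proof -
  let ?c = "\<lambda>a b (m::nat). if m = 0 then b else if m = 1 then a else (0::'a)"
  note D = subalgebraD[OF skew_poly_ringD(4)[OF S]]
  have sum: "(\<Sum>m\<in>{0,1}. ?c a b m * x ^ m) = a * x + b" for a b
    by (simp add: add.commute)
  have "?c a b = ?c a' b'"
  proof (rule unique_coefficients[OF skew_poly_ringD(8)[OF S], where F = "{0,1}"])
    show "(\<Sum>m\<in>{0,1}. ?c a b m * x ^ m) \<in> S"
      unfolding sum using assms skew_poly_ringD(5,6)[OF S] by (auto intro!: D)
    show "(\<Sum>m\<in>{0,1}. ?c a b m * x ^ m) = (\<Sum>m\<in>{0,1}. ?c a' b' m * x ^ m)"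
      unfolding sum by fact
  qed (use assms subalgebraD(5)[OF skew_poly_ringD(1)[OF S]] in auto)
  from fun_cong[OF this, of 0] fun_cong[OF this, of 1] show "a = a'" "b = b'" by auto
qed

text \<open>The product rule on \<open>1 * 1\<close> reads
  \<open>\<delta> 1 = \<delta> 1 + \<delta> 1\<close>. It is needed because the extended derivation
  sends y, which is 1 times y, to \<open>\<delta> 1 * y\<close>.\<close>

lemma skew_derivation_one:
  assumes "subalgebra scale B" "algebra_automorphism_on scale B \<tau>" "skew_derivation_on scale B \<tau> \<delta>"
  shows "\<delta> 1 = 0"
proof -
  have "\<delta> (1 * 1) = \<tau> 1 * \<delta> 1 + \<delta> 1 * 1"
    using assms(3) subalgebraD(1)[OF assms(1)] unfolding skew_derivation_on_def by blast
  then show ?thesis using automorphism_onD(3)[OF assms(2)] by simp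
qed

text \<open>By strong induction the inner terms of the product rule on \<open>1 * 1\<close> vanish.
  The terms \<open>i = 0\<close> and \<open>i = p\<close> each equal \<open>d p 1\<close>, so
  \<open>d p 1\<close> is twice itself.\<close>

lemma higher_skew_derivation_one:
  assumes B: "subalgebra scale B" "algebra_automorphism_on scale B \<tau>"
    and d: "higher_skew_derivation_on scale B q \<tau> d" and "p \<ge> 1"
  shows "d p 1 = 0"
  using \<open>p \<ge> 1\<close>
proof (induction p rule: less_induct)
  case (less p)
  have lin: "linear_operator_on scale B (d i)" and d0: "d 0 1 = 1" for i
    using d subalgebraD(1)[OF B(1)] by (auto simp: higher_skew_derivation_on_def)
  have "d p (1 * 1) = (\<Sum>i=0..p. (\<tau> ^^ (p - i)) (d i 1) * d (p - i) 1)"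
    using d subalgebraD(1)[OF B(1)] unfolding higher_skew_derivation_on_def by blast
  also have "\<dots> = (\<Sum>i\<in>{0,p}. (\<tau> ^^ (p - i)) (d i 1) * d (p - i) 1)"
  proof (rule sum.mono_neutral_right)
    show "\<forall>i\<in>{0..p} - {0, p}. (\<tau> ^^ (p - i)) (d i 1) * d (p - i) 1 = 0"
    proof
      fix i assume "i \<in> {0..p} - {0, p}"
      then have "d (p - i) 1 = 0" by (intro less.IH) auto
      then show "(\<tau> ^^ (p - i)) (d i 1) * d (p - i) 1 = 0" by simp
    qed
  qed auto
  also have "\<dots> = d p 1 + d p 1"
    using less.prems d0 funpow_fixpoint[of \<tau> 1] automorphism_onD(3)[OF B(2)] by auto
  finally show ?case by simp
qed

lemma iterated_skew_poly_ringD: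
  assumes "iterated_skew_poly_ring scale R n x \<tau> \<delta> S"
  shows "S 0 = R" "i \<in> {1..n} \<Longrightarrow> skew_poly_ring scale (S (i - 1)) (x i) (\<tau> i) (\<delta> i) (S i)"
    "j < n \<Longrightarrow> skew_poly_ring scale (S j) (x (Suc j)) (\<tau> (Suc j)) (\<delta> (Suc j)) (S (Suc j))"
    "j \<le> n \<Longrightarrow> subalgebra scale (S j)"
proof -
  show *: "S 0 = R" "i \<in> {1..n} \<Longrightarrow> skew_poly_ring scale (S (i - 1)) (x i) (\<tau> i) (\<delta> i) (S i)" for i
    using assms by (auto simp: iterated_skew_poly_ring_def)
  show **: "j < n \<Longrightarrow> skew_poly_ring scale (S j) (x (Suc j)) (\<tau> (Suc j)) (\<delta> (Suc j)) (S (Suc j))" for j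
    using *(2)[of "Suc j"] by simp
  show "j \<le> n \<Longrightarrow> subalgebra scale (S j)"
    using assms skew_poly_ringD(4)[OF **] by (cases j) (auto simp: iterated_skew_poly_ring_def)
qed

lemma iterated_skew_poly_ring_mono:
  assumes S: "iterated_skew_poly_ring scale R n x \<tau> \<delta> S" and "i \<le> j" "j \<le> n"
  shows "S i \<subseteq> S j"
  using assms(2,3)
proof (induction j rule: dec_induct)
  case (step j)
  then show ?case using skew_poly_ringD(5)[OF iterated_skew_poly_ringD(3)[OF S, of j]] by auto
qed simp

lemma iterated_skew_poly_ring_generators:
  assumes S: "iterated_skew_poly_ring scale R n x \<tau> \<delta> S" and "j \<le> n"
  shows "R \<subseteq> S j" "x ` {1..j} \<subseteq> S j"
proof -
  show "R \<subseteq> S j"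
    using iterated_skew_poly_ring_mono[OF S _ \<open>j \<le> n\<close>, of 0] iterated_skew_poly_ringD(1)[OF S] by simp
  show "x ` {1..j} \<subseteq> S j"
  proof (rule image_subsetI)
    fix i assume i: "i \<in> {1..j}"
    then have "x i \<in> S i"
      using skew_poly_ringD(6)[OF iterated_skew_poly_ringD(2)[OF S, of i]] \<open>j \<le> n\<close> by auto
    then show "x i \<in> S j" using iterated_skew_poly_ring_mono[OF S _ \<open>j \<le> n\<close>, of i] i by auto
  qed
qed

lemma iterated_skew_poly_ring_minimal:
  assumes S: "iterated_skew_poly_ring scale R n x \<tau> \<delta> S"
    and D: "subalgebra scale D" "R \<subseteq> D" "x ` {1..j} \<subseteq> D" and "j \<le> n"
  shows "S j \<subseteq> D"
  using D(3) \<open>j \<le> n\<close>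
proof (induction j)
  case 0
  then show ?case using D(2) iterated_skew_poly_ringD(1)[OF S] by simp
next
  case (Suc j)
  then have "S j \<subseteq> D" "x (Suc j) \<in> D" by (simp_all add: image_subset_iff)
  then show ?case
    using Suc.prems skew_poly_ring_minimal[OF iterated_skew_poly_ringD(3)[OF S, of j] D(1)] by auto
qed

text \<open>Both inclusions follow from minimality. The preimage and the image of \<open>S j\<close>
  under \<sigma> are subalgebras containing the generators; for the image, \<open>x i\<close> comes
  from \<open>scale (inverse (lam i)) (x i)\<close>.\<close>

lemma iterated_skew_poly_ring_invariant:
  assumes S: "iterated_skew_poly_ring scale R n x \<tau> \<delta> S" and \<sigma>: "algebra_automorphism_on scale (S n) \<sigma>"
    and R: "\<sigma> ` R = R" and x: "\<And>i. i \<in> {1..n} \<Longrightarrow> lam i \<noteq> 0 \<and> \<sigma> (x i) = scale (lam i) (x i)"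
    and "j \<le> n"
  shows "\<sigma> ` S j = S j"
proof
  note Sj = iterated_skew_poly_ringD(4)[OF S \<open>j \<le> n\<close>] and Sn = iterated_skew_poly_ringD(4)[OF S order_refl]
  note sub = iterated_skew_poly_ring_mono[OF S \<open>j \<le> n\<close> order_refl]
  note gen = iterated_skew_poly_ring_generators[OF S \<open>j \<le> n\<close>]
  note lin = linear_operator_on_D[OF automorphism_onD(1)[OF \<sigma>]]
  have xj: "x i \<in> S j" "lam i \<noteq> 0" "\<sigma> (x i) = scale (lam i) (x i)" if "i \<in> {1..j}" for i
    using that gen x[of i] \<open>j \<le> n\<close> by auto
  have "S j \<subseteq> {a \<in> S n. \<sigma> a \<in> S j}"
    using gen(1) sub R xj subalgebraD(4)[OF Sj]
    by (intro iterated_skew_poly_ring_minimal[OF S _ _ _ \<open>j \<le> n\<close>] subalgebra_vimage[OF Sn \<sigma> Sj])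
      auto
  then show "\<sigma> ` S j \<subseteq> S j" by auto
  have "x i \<in> \<sigma> ` S j" if "i \<in> {1..j}" for i
  proof
    show "scale (inverse (lam i)) (x i) \<in> S j"
      by (rule subalgebraD(4)[OF Sj xj(1)[OF that]])
    show "x i = \<sigma> (scale (inverse (lam i)) (x i))"
      using xj[OF that] sub lin(3)[of "x i"] by auto
  qed
  moreover have "R \<subseteq> \<sigma> ` S j"
    using image_mono[OF gen(1), of \<sigma>] R by simp
  ultimately show "S j \<subseteq> \<sigma> ` S j"
    by (intro iterated_skew_poly_ring_minimal[OF S _ _ _ \<open>j \<le> n\<close>]
        subalgebra_linear_image[OF Sn sub \<sigma> Sj]) auto
qed

end

section \<open>Integer powers of a unit\<close>

lemma unit_power_Suc_right:
  fixes y yi :: "'a::monoid_mult"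
  assumes "y * yi = 1" "yi * y = 1"
  shows "unit_power y yi (m + 1) = unit_power y yi m * y"
    and "unit_power y yi (m - 1) = unit_power y yi m * yi"
proof -
  have *: "unit_power y yi (m + 1) = unit_power y yi m * y" for m
  proof (cases "m \<ge> 0")
    case True
    then show ?thesis by (simp add: unit_power_def nat_add_distrib power_Suc2 del: power_Suc)
  next
    case False
    \<comment> \<open>Writing m as -(k+1) exposes one factor \<open>yi\<close>, which the extra
      \<open>y\<close> cancels.\<close>
    then obtain k where k: "m = - int (Suc k)" by (metis not_le negD)
    have "unit_power y yi (m + 1) = yi ^ k" using k by (cases k) (auto simp: unit_power_def nat_add_distrib)
    moreover have "unit_power y yi m = yi ^ k * yi"
      using k by (simp add: unit_power_def power_Suc2 nat_add_distrib del: power_Suc)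
    ultimately show ?thesis using assms by (simp add: mult.assoc)
  qed
  then show "unit_power y yi (m + 1) = unit_power y yi m * y" .
  from *[of "m - 1"] have "unit_power y yi m * yi = unit_power y yi (m - 1) * (y * yi)"
    by (simp add: mult.assoc)
  then show "unit_power y yi (m - 1) = unit_power y yi m * yi" using assms by simp
qed

lemma unit_power_add:
  fixes y yi :: "'a::monoid_mult"
  assumes "y * yi = 1" "yi * y = 1"
  shows "unit_power y yi (m + l) = unit_power y yi m * unit_power y yi l"
proof (induction l rule: int_induct[where k = 0])
  case base
  show ?case by (simp add: unit_power_def)
next
  case (step1 i)
  then show ?case
    using unit_power_Suc_right(1)[OF assms, of "m + i"] unit_power_Suc_right(1)[OF assms, of i]
    by (simp add: mult.assoc add.assoc)
next
  case (step2 i)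
  then show ?case
    using unit_power_Suc_right(2)[OF assms, of "m + i"] unit_power_Suc_right(2)[OF assms, of i]
    by (simp add: mult.assoc algebra_simps)
qed

subsection \<open>Coefficients in a skew Laurent ring\<close>

locale skew_laurent = k_algebra scale
  for scale :: "'k::field \<Rightarrow> 'a::{ring,monoid_mult} \<Rightarrow> 'a" +
  fixes N :: "'a set" and y yi :: 'a and \<sigma> :: "'a \<Rightarrow> 'a" and Ahat :: "'a set"
  assumes laurent: "skew_laurent_ring scale N y yi \<sigma> Ahat"
begin

abbreviation Y :: "int \<Rightarrow> 'a" where "Y \<equiv> unit_power y yi"

lemma N_subalgebra: "subalgebra scale N" and \<sigma>_automorphism: "algebra_automorphism_on scale N \<sigma>"
  and Ahat_subalgebra: "subalgebra scale Ahat" and N_subset: "N \<subseteq> Ahat"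
  and y_in: "y \<in> Ahat" and yi_in: "yi \<in> Ahat" and y_yi: "y * yi = 1" and yi_y: "yi * y = 1"
  and y_mult: "r \<in> N \<Longrightarrow> y * r = \<sigma> r * y"
  and laurent_free: "\<forall>s\<in>Ahat. \<exists>!c :: int \<Rightarrow> 'a. range c \<subseteq> N \<and> finite {m. c m \<noteq> 0} \<and>
        s = (\<Sum>m | c m \<noteq> 0. c m * Y m)"
  using laurent unfolding skew_laurent_ring_def by blast+

lemmas N = subalgebraD[OF N_subalgebra]
lemmas Ahat = subalgebraD[OF Ahat_subalgebra]
lemmas Y_add = unit_power_add[OF y_yi yi_y]

lemma Y_0 [simp]: "Y 0 = 1" and Y_1: "Y 1 = y" and Y_minus_1: "Y (-1) = yi"
  by (simp_all add: unit_power_def)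

lemma Y_of_nat: "Y (int m) = y ^ m"
  by (simp add: unit_power_def)

lemma Y_in: "Y m \<in> Ahat"
  by (auto simp: unit_power_def intro!: subalgebra_power Ahat_subalgebra y_in yi_in)

lemma Y_inverse [simp]: "Y m * Y (- m) = 1" "Y (- m) * Y m = 1"
  using Y_add[of m "- m"] Y_add[of "- m" m] by simp_all

lemma Y_in_subalgebra: "subalgebra scale D \<Longrightarrow> y \<in> D \<Longrightarrow> m \<ge> 0 \<or> yi \<in> D \<Longrightarrow> Y m \<in> D"
  by (auto simp: unit_power_def intro!: subalgebra_power)

text \<open>Left coefficients in powers of y. The description is justified by freeness only for
  \<open>s \<in> Ahat\<close>; elsewhere the value is unspecified.\<close>

definition cf :: "'a \<Rightarrow> int \<Rightarrow> 'a" where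
  "cf s = (THE c. range c \<subseteq> N \<and> finite {m. c m \<noteq> 0} \<and> s = (\<Sum>m | c m \<noteq> 0. c m * Y m))"

lemma
  assumes "s \<in> Ahat"
  shows cf_in: "cf s m \<in> N" and cf_finite: "finite {m. cf s m \<noteq> 0}"
    and cf_sum: "(\<Sum>m | cf s m \<noteq> 0. cf s m * Y m) = s"
proof -
  have "range (cf s) \<subseteq> N \<and> finite {m. cf s m \<noteq> 0} \<and> s = (\<Sum>m | cf s m \<noteq> 0. cf s m * Y m)"
    unfolding cf_def by (rule theI'[OF laurent_free[rule_format, OF assms]])
  then show "cf s m \<in> N" "finite {m. cf s m \<noteq> 0}" "(\<Sum>m | cf s m \<noteq> 0. cf s m * Y m) = s"
    by auto
qed

lemma cf_sum_superset:
  assumes "s \<in> Ahat" "finite F" "\<And>m. m \<notin> F \<Longrightarrow> cf s m = 0"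
  shows "(\<Sum>m\<in>F. cf s m * Y m) = s"
  using sum_support[OF assms(2,3), where e = Y] cf_sum[OF assms(1)] by simp

text \<open>The working tool for computing coefficients: any finite presentation as a sum of
  monomials determines them, and also certifies membership in \<open>Ahat\<close>.\<close>

lemma cf_eqI:
  assumes "finite F" "\<And>m. c m \<in> N" "\<And>m. m \<notin> F \<Longrightarrow> c m = 0" "s = (\<Sum>m\<in>F. c m * Y m)"
  shows "cf s = c" and "s \<in> Ahat"
proof -
  show s: "s \<in> Ahat"
    unfolding assms(4) using assms(2) N_subset Y_in
    by (intro subalgebra_sum Ahat_subalgebra Ahat(3)) auto
  let ?F = "F \<union> {m. cf s m \<noteq> 0}"
  have fin: "finite ?F" using assms(1) cf_finite[OF s] by simp
  have s_eq: "(\<Sum>m\<in>?F. cf s m * Y m) = s"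
    by (rule cf_sum_superset[OF s fin]) auto
  have "(\<Sum>m\<in>F. c m * Y m) = (\<Sum>m\<in>?F. c m * Y m)"
    by (rule sum.mono_neutral_left) (use assms fin in auto)
  then show "cf s = c"
    using s s_eq assms cf_in[OF s]
    by (intro unique_coefficients[OF laurent_free, where F = ?F] fin) auto
qed

lemma cf_eqD: "s \<in> Ahat \<Longrightarrow> t \<in> Ahat \<Longrightarrow> cf s = cf t \<Longrightarrow> s = t"
  using cf_sum by metis

lemma cf_monomial: "a \<in> N \<Longrightarrow> cf (a * Y m) = (\<lambda>l. if l = m then a else 0)"
  by (rule cf_eqI[where F = "{m}"]) (auto simp: N)

lemma cf_zero: "cf 0 = (\<lambda>_. 0)"
  by (rule cf_eqI[where F = "{}"]) (auto simp: N)

lemma cf_add: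
  assumes "s \<in> Ahat" "t \<in> Ahat"
  shows "cf (s + t) = (\<lambda>m. cf s m + cf t m)"
proof -
  let ?F = "{m. cf s m \<noteq> 0} \<union> {m. cf t m \<noteq> 0}"
  have fin: "finite ?F" using assms cf_finite by auto
  have "s = (\<Sum>m\<in>?F. cf s m * Y m)" "t = (\<Sum>m\<in>?F. cf t m * Y m)"
    by (rule cf_sum_superset[symmetric, OF _ fin]; use assms in auto)+
  then have "s + t = (\<Sum>m\<in>?F. (cf s m + cf t m) * Y m)"
    by (simp add: sum.distrib distrib_right)
  then show ?thesis
    by (intro cf_eqI[OF fin]) (auto simp: assms cf_in N)
qed

lemma cf_scale:
  assumes "s \<in> Ahat"
  shows "cf (scale c s) = (\<lambda>m. scale c (cf s m))"
proof (rule cf_eqI[OF cf_finite[OF assms]])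
  show "scale c s = (\<Sum>m | cf s m \<noteq> 0. scale c (cf s m) * Y m)"
    by (subst cf_sum[OF assms, symmetric], simp add: scale_sum_right scale_mult_left)
qed (auto simp: assms cf_in N)

lemma cf_sum_distrib:
  "(\<And>i. i \<in> I \<Longrightarrow> g i \<in> Ahat) \<Longrightarrow> cf (\<Sum>i\<in>I. g i) = (\<lambda>m. \<Sum>i\<in>I. cf (g i) m)"
  by (induction I rule: infinite_finite_induct)
    (auto simp: cf_zero cf_add subalgebra_sum[OF Ahat_subalgebra])

definition stable :: "'a set \<Rightarrow> bool" where
  "stable C \<longleftrightarrow> subalgebra scale C \<and> C \<subseteq> N \<and> \<sigma> ` C = C"

text \<open>A submonoid of the integers: the exponents of y that may occur. It allows the polynomial
  and the Laurent case to share every proof.\<close>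

definition exponents :: "int set \<Rightarrow> bool" where
  "exponents M \<longleftrightarrow> 0 \<in> M \<and> (\<forall>m\<in>M. \<forall>l\<in>M. m + l \<in> M)"

lemma exponents_UNIV: "exponents UNIV" and exponents_nonneg: "exponents {0..}"
  by (auto simp: exponents_def)

text \<open>For \<open>C = A\<^sub>j\<close>, the exponent set \<open>M = UNIV\<close> gives \<open>Bhat j\<close> and \<open>M = {0..}\<close> gives \<open>B j\<close>.\<close>

definition part :: "int set \<Rightarrow> 'a set \<Rightarrow> 'a set" where
  "part M C = {s \<in> Ahat. (\<forall>m. cf s m \<in> C) \<and> (\<forall>m. m \<notin> M \<longrightarrow> cf s m = 0)}"

lemma stableD:
  assumes "stable C"
  shows "subalgebra scale C" "C \<subseteq> N" "\<sigma> ` C = C"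
  using assms by (auto simp: stable_def)

lemma part_in_Ahat: "s \<in> part M C \<Longrightarrow> s \<in> Ahat"
  and part_cf: "s \<in> part M C \<Longrightarrow> cf s m \<in> C"
  and part_cf_zero: "s \<in> part M C \<Longrightarrow> m \<notin> M \<Longrightarrow> cf s m = 0"
  by (auto simp: part_def)

lemma part_mono: "C \<subseteq> D \<Longrightarrow> part M C \<subseteq> part M D"
  by (auto simp: part_def)

context
  fixes C :: "'a set" and M :: "int set"
  assumes stab: "stable C" and M: "exponents M"
begin

private lemmas C = subalgebraD[OF stableD(1)[OF stab]]

lemma part_monomial: "a \<in> C \<Longrightarrow> m \<in> M \<Longrightarrow> a * Y m \<in> part M C"
  using stableD(2)[OF stab] N_subset by (auto simp: part_def cf_monomial C Ahat Y_in subset_iff)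

lemma part_const: "a \<in> C \<Longrightarrow> a \<in> part M C"
  using part_monomial[of a 0] M by (simp add: exponents_def)

lemma part_zero: "0 \<in> part M C"
  by (rule part_const[OF C(5)])

lemma part_add: "s \<in> part M C \<Longrightarrow> t \<in> part M C \<Longrightarrow> s + t \<in> part M C"
  by (auto simp: part_def cf_add Ahat C)

lemma part_scale: "s \<in> part M C \<Longrightarrow> scale c s \<in> part M C"
  by (auto simp: part_def cf_scale Ahat C)

end

text \<open>Every element is a finite sum of its own monomials, so additive properties need only be
  checked on \<open>a * Y m\<close>.\<close>

lemma part_induct [consumes 3, case_names monomial add]:
  assumes stab: "stable C" and M: "exponents M" and s: "s \<in> part M C"
    and mono: "\<And>a m. a \<in> C \<Longrightarrow> m \<in> M \<Longrightarrow> P (a * Y m)"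
    and add: "\<And>s t. s \<in> part M C \<Longrightarrow> t \<in> part M C \<Longrightarrow> P s \<Longrightarrow> P t \<Longrightarrow> P (s + t)"
  shows "P s"
proof -
  \<comment> \<open>Zero needs no case of its own: it is the monomial with coefficient 0 and
    exponent 0, and \<open>0 \<in> M\<close>.\<close>
  have 0: "P 0" using mono[OF subalgebraD(5)[OF stableD(1)[OF stab]], of 0] M by (simp add: exponents_def)
  have "sum (\<lambda>m. cf s m * Y m) F \<in> part M C \<and> P (sum (\<lambda>m. cf s m * Y m) F)"
    if "finite F" "F \<subseteq> M" for F
    using that
    by (induction F rule: finite_induct)
      (auto simp: 0 part_zero[OF stab M] intro!: part_add[OF stab M] part_monomial[OF stab M] mono add part_cf[OF s])
  from this[of "{m. cf s m \<noteq> 0}"] show "P s"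
    using cf_finite[OF part_in_Ahat[OF s]] part_cf_zero[OF s] cf_sum[OF part_in_Ahat[OF s]]
    by auto
qed

text \<open>On \<open>N\<close> this is the m-th power of \<sigma>, with negative m included and no
  inverse map to choose; the formula makes sense on the whole ambient algebra.\<close>

definition conj :: "int \<Rightarrow> 'a \<Rightarrow> 'a" where
  "conj m a = Y m * a * Y (- m)"

lemma Y_mult: "Y m * a = conj m a * Y m"
  by (simp add: conj_def mult.assoc)

lemma conj_0 [simp]: "conj 0 a = a"
  by (simp add: conj_def)

lemma conj_conj: "conj m (conj l a) = conj (m + l) a"
proof -
  have "Y (- (m + l)) = Y (- l) * Y (- m)"
    by (subst Y_add[symmetric]) (simp add: algebra_simps)
  then show ?thesis by (simp only: conj_def mult.assoc Y_add[of m l])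
qed

lemma conj_scale: "conj m (scale c a) = scale c (conj m a)"
  by (simp add: conj_def scale_mult_left scale_mult_right[symmetric])

lemma conj_1: "a \<in> N \<Longrightarrow> conj 1 a = \<sigma> a"
  using y_mult[of a] y_yi by (simp add: conj_def Y_1 Y_minus_1 mult.assoc)

text \<open>Upwards one applies \<sigma>. Downwards surjectivity of \<sigma> on \<open>C\<close> is
  used: if \<open>conj m a = \<sigma> b\<close> with \<open>b \<in> C\<close>, then
  \<open>conj (m - 1) a = b\<close>.\<close>

lemma conj_in:
  assumes C: "stable C" and "a \<in> C"
  shows "conj m a \<in> C"
proof (induction m rule: int_induct[where k = 0])
  case (step1 m)
  then have "conj 1 (conj m a) \<in> C"
    using stableD[OF C] by (subst conj_1) auto
  then show ?case by (simp add: conj_conj add.commute)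
next
  case (step2 m)
  then obtain b where b: "b \<in> C" "conj m a = \<sigma> b"
    using stableD(3)[OF C] by blast
  then have "conj (- 1) (conj m a) = conj (- 1) (conj 1 b)"
    using stableD(2)[OF C] conj_1[of b] by auto
  then have "conj (m - 1) a = b"
    by (simp add: conj_conj)
  with b show ?case by simp
qed (use assms in simp)

text \<open>Iterates a commutation rule with \<sigma> over all integer powers. It is applied with
  \<nu> = 1 to \<tau>, with \<nu> = \<rho> to \<delta>, and with \<nu> the p-th power of \<rho> to
  \<open>d p\<close>.\<close>

lemma conj_intertwine:
  assumes C: "stable C" and f: "linear_operator_on scale C f"
    and comm: "\<And>a. a \<in> C \<Longrightarrow> f (\<sigma> a) = scale \<nu> (\<sigma> (f a))" and "\<nu> \<noteq> 0" and "a \<in> C"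
  shows "f (conj m a) = scale (\<nu> powi m) (conj m (f a))"
proof -
  note f = linear_operator_on_D[OF f]
  have up: "f (conj 1 b) = scale \<nu> (conj 1 (f b))" if "b \<in> C" for b
    using comm[OF that] f(1)[OF that] that stableD(2)[OF C] by (auto simp: conj_1 subset_iff)
  show ?thesis
  proof (induction m rule: int_induct[where k = 0])
    case base
    show ?case by simp
  next
    case (step1 m)
    have "f (conj (m + 1) a) = scale \<nu> (conj 1 (f (conj m a)))"
      using up[OF conj_in[OF C \<open>a \<in> C\<close>, of m]] by (simp add: conj_conj add.commute)
    then show ?case
      using \<open>\<nu> \<noteq> 0\<close> step1 by (simp add: conj_scale conj_conj add.commute power_int_add)
  next
    case (step2 m)
    \<comment> \<open>Going down, the one-step rule is used at \<open>conj (m - 1) a\<close> and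
      solved for \<open>f (conj (m - 1) a)\<close>: first cancel \<nu>, then apply
      \<open>conj (- 1)\<close>.\<close>
    have "f (conj m a) = scale \<nu> (conj 1 (f (conj (m - 1) a)))"
      using up[OF conj_in[OF C \<open>a \<in> C\<close>, of "m - 1"]] by (simp add: conj_conj)
    then have "scale \<nu> (conj 1 (f (conj (m - 1) a))) = scale (\<nu> powi m) (conj m (f a))"
      using step2 by simp
    then have "conj 1 (f (conj (m - 1) a)) = scale (\<nu> powi (m - 1)) (conj m (f a))"
      using \<open>\<nu> \<noteq> 0\<close> by (metis scale_scale scale_left_imp_eq power_int_diff power_int_1_right times_divide_eq_right nonzero_mult_div_cancel_left)
    then have "conj (- 1) (conj 1 (f (conj (m - 1) a))) = scale (\<nu> powi (m - 1)) (conj (- 1) (conj m (f a)))"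
      by (simp add: conj_scale)
    then show ?case by (simp add: conj_conj)
  qed
qed

lemma monomial_mult: "(a * Y m) * (b * Y l) = (a * conj m b) * Y (m + l)"
proof -
  have "(a * Y m) * (b * Y l) = a * (Y m * b) * Y l" by (simp add: mult.assoc)
  then show ?thesis unfolding Y_mult by (simp add: mult.assoc Y_add)
qed

text \<open>For monomials, exponents add inside \<open>M\<close> and the coefficient
  \<open>a * conj m b\<close> stays in \<open>C\<close> by stability; double induction gives all
  products.\<close>

lemma part_subalgebra:
  assumes C: "stable C" and M: "exponents M"
  shows "subalgebra scale (part M C)"
proof -
  note CD = subalgebraD[OF stableD(1)[OF C]]
  have mult: "s * t \<in> part M C" if s: "s \<in> part M C" and t: "t \<in> part M C" for s t
    using C M s
  proof (induction rule: part_induct)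
    case (monomial a m)
    from C M t show ?case
    proof (induction rule: part_induct)
      case (monomial b l)
      show ?case unfolding monomial_mult
        using \<open>a \<in> C\<close> \<open>b \<in> C\<close> \<open>m \<in> M\<close> \<open>l \<in> M\<close> M
        by (intro part_monomial[OF C M] CD(3) conj_in[OF C]) (auto simp: exponents_def)
    next
      case (add s t)
      then show ?case unfolding distrib_left by (intro part_add[OF C M])
    qed
  next
    case (add s t)
    then show ?case unfolding distrib_right by (intro part_add[OF C M])
  qed
  have "1 \<in> part M C" by (rule part_const[OF C M CD(1)])
  with mult show ?thesis
    unfolding subalgebra_def by (auto simp: part_add[OF C M] part_scale[OF C M])
qed

text \<open>The operator may depend on the exponent, because the extension of \<tau> multiplies the
  m-th coefficient by a scalar depending on m.\<close>

definition coeffwise :: "(int \<Rightarrow> 'a \<Rightarrow> 'a) \<Rightarrow> 'a \<Rightarrow> 'a" where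
  "coeffwise f s = (\<Sum>m | cf s m \<noteq> 0. f m (cf s m) * Y m)"

lemma
  assumes C: "stable C" and f: "\<And>m. linear_operator_on scale C (f m)" and s: "s \<in> part M C"
  shows cf_coeffwise: "cf (coeffwise f s) = (\<lambda>m. f m (cf s m))"
    and coeffwise_in: "coeffwise f s \<in> part M C"
proof -
  have f0: "f m 0 = 0" for m
    by (rule linear_operator_on_zero[OF f stableD(1)[OF C]])
  have fC: "f m (cf s m) \<in> C" for m
    by (rule linear_operator_on_D(1)[OF f part_cf[OF s]])
  have *: "cf (coeffwise f s) = (\<lambda>m. f m (cf s m))" "coeffwise f s \<in> Ahat"
    using cf_eqI[OF cf_finite[OF part_in_Ahat[OF s]], of "\<lambda>m. f m (cf s m)" "coeffwise f s"]
      fC stableD(2)[OF C] f0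
    by (auto simp: coeffwise_def)
  then show "cf (coeffwise f s) = (\<lambda>m. f m (cf s m))" by simp
  show "coeffwise f s \<in> part M C"
    using * fC f0 part_cf_zero[OF s] by (auto simp: part_def)
qed

lemma coeffwise_monomial:
  assumes "stable C" "\<And>m. linear_operator_on scale C (f m)" "a \<in> C"
  shows "coeffwise f (a * Y m) = f m a * Y m"
proof -
  have "a \<in> N" using assms stableD(2) by blast
  moreover have "f m 0 = 0" by (rule linear_operator_on_zero[OF assms(2) stableD(1)[OF assms(1)]])
  moreover have "{l. (if l = m then a else 0) \<noteq> 0} = (if a = 0 then {} else {m})" by auto
  ultimately show ?thesis
    by (simp add: coeffwise_def cf_monomial)
qed

lemma coeffwise_linear:
  assumes C: "stable C" and M: "exponents M" and f: "\<And>m. linear_operator_on scale C (f m)"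
  shows "linear_operator_on scale (part M C) (coeffwise f)"
proof -
  note in_part = coeffwise_in[OF C f] part_add[OF C M] part_scale[OF C M]
  note in_Ahat = in_part[THEN part_in_Ahat] part_in_Ahat[where M = M and C = C]
  note cf = cf_coeffwise[OF C f, where M = M] cf_add cf_scale part_cf[where M = M and C = C] linear_operator_on_D[OF f]
  have "coeffwise f (s + t) = coeffwise f s + coeffwise f t"
    if "s \<in> part M C" "t \<in> part M C" for s t
    using that by (intro cf_eqD) (simp_all add: cf in_Ahat in_part Ahat)
  moreover have "coeffwise f (scale c s) = scale c (coeffwise f s)"
    if "s \<in> part M C" for s c
    using that by (intro cf_eqD) (simp_all add: cf in_Ahat in_part Ahat)
  ultimately show ?thesis
    unfolding linear_operator_on_def using in_part(1) by (intro conjI ballI allI image_subsetI)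
qed

subsection \<open>Coefficientwise extension of operators\<close>

text \<open>With \<open>\<rho> = \<lambda>\<^sub>i\<inverse>\<close>, these are \<open>\<tau>\<^sub>i'\<close> and (for \<open>f = \<delta>\<^sub>i\<close> or \<open>f = d\<^sub>i\<^sub>,\<^sub>p\<close>) \<open>\<delta>\<^sub>i'\<close>, \<open>d\<^sub>i\<^sub>,\<^sub>p'\<close>.\<close>

definition twist :: "'k \<Rightarrow> ('a \<Rightarrow> 'a) \<Rightarrow> 'a \<Rightarrow> 'a" where
  "twist \<rho> \<tau> = coeffwise (\<lambda>m a. scale (\<rho> powi m) (\<tau> a))"

definition lift :: "('a \<Rightarrow> 'a) \<Rightarrow> 'a \<Rightarrow> 'a" where
  "lift f = coeffwise (\<lambda>_. f)"

text \<open>Both \<open>F (s * t)\<close> and \<open>G s t\<close> are additive in each argument, so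
  a product rule holds as soon as it holds for two monomials. Multiplicativity of
  \<open>twist\<close> and the product rules of both kinds of derivation all go through
  this.\<close>

lemma part_mult_induct:
  assumes C: "stable C" and M: "exponents M" and F: "linear_operator_on scale (part M C) F"
    and G1: "\<And>s s' t. s \<in> part M C \<Longrightarrow> s' \<in> part M C \<Longrightarrow> t \<in> part M C \<Longrightarrow> G (s + s') t = G s t + G s' t"
    and G2: "\<And>s t t'. s \<in> part M C \<Longrightarrow> t \<in> part M C \<Longrightarrow> t' \<in> part M C \<Longrightarrow> G s (t + t') = G s t + G s t'"
    and mono: "\<And>a b m l. a \<in> C \<Longrightarrow> b \<in> C \<Longrightarrow> m \<in> M \<Longrightarrow> l \<in> M \<Longrightarrow>
        F ((a * conj m b) * Y (m + l)) = G (a * Y m) (b * Y l)"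
    and s: "s \<in> part M C" and t: "t \<in> part M C"
  shows "F (s * t) = G s t"
  using C M s
proof (induction rule: part_induct)
  note mult = subalgebraD(3)[OF part_subalgebra[OF C M]]
  note F = linear_operator_on_D(2)[OF F]
  case (monomial a m)
  note am = part_monomial[OF C M monomial]
  from C M t show ?case
  proof (induction rule: part_induct)
    case (monomial b l)
    show ?case unfolding monomial_mult using mono \<open>a \<in> C\<close> \<open>m \<in> M\<close> monomial by simp
  next
    case (add s t)
    then show ?case unfolding distrib_left by (simp add: F mult am G2)
  qed
next
  note mult = subalgebraD(3)[OF part_subalgebra[OF C M]]
  note F = linear_operator_on_D(2)[OF F]
  case (add u v)
  then show ?case unfolding distrib_right by (simp add: F mult G1 t)
qed

context
  fixes C :: "'a set" and M :: "int set" and \<rho> :: 'k and \<tau> :: "'a \<Rightarrow> 'a"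
  assumes C: "stable C" and M: "exponents M" and \<rho>: "\<rho> \<noteq> 0"
    and \<tau>: "algebra_automorphism_on scale C \<tau>" and \<tau>\<sigma>: "\<And>a. a \<in> C \<Longrightarrow> \<tau> (\<sigma> a) = \<sigma> (\<tau> a)"
begin

private lemmas C_alg = subalgebraD[OF stableD(1)[OF C]]
private lemmas part_alg = subalgebraD[OF part_subalgebra[OF C M]]
private lemmas cf_C = part_cf[where M = M and C = C] part_in_Ahat[where M = M and C = C]
private lemmas \<tau>D = automorphism_onD[OF \<tau>] linear_operator_on_D[OF automorphism_onD(1)[OF \<tau>]]

lemma twist_coeff_linear: "linear_operator_on scale C (\<lambda>a. scale (\<rho> powi m) (\<tau> a))"
  by (rule linear_operator_on_scale[OF stableD(1)[OF C] \<tau>D(1)])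

lemma twist_linear: "linear_operator_on scale (part M C) (twist \<rho> \<tau>)"
  unfolding twist_def by (rule coeffwise_linear[OF C M twist_coeff_linear])

lemma lift_linear: "linear_operator_on scale C f \<Longrightarrow> linear_operator_on scale (part M C) (lift f)"
  unfolding lift_def by (rule coeffwise_linear[OF C M])

lemma twist_monomial: "a \<in> C \<Longrightarrow> twist \<rho> \<tau> (a * Y m) = scale (\<rho> powi m) (\<tau> a) * Y m"
  unfolding twist_def by (rule coeffwise_monomial[OF C twist_coeff_linear])

lemma lift_monomial: "linear_operator_on scale C f \<Longrightarrow> a \<in> C \<Longrightarrow> lift f (a * Y m) = f a * Y m"
  unfolding lift_def by (rule coeffwise_monomial[OF C])

lemma twist_const: "a \<in> C \<Longrightarrow> twist \<rho> \<tau> a = \<tau> a"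
  using twist_monomial[of a 0] by simp

lemma lift_const: "linear_operator_on scale C f \<Longrightarrow> a \<in> C \<Longrightarrow> lift f a = f a"
  using lift_monomial[of f a 0] by simp

lemma cf_twist: "s \<in> part M C \<Longrightarrow> cf (twist \<rho> \<tau> s) m = scale (\<rho> powi m) (\<tau> (cf s m))"
  unfolding twist_def by (simp add: cf_coeffwise[OF C twist_coeff_linear])

lemma cf_lift: "linear_operator_on scale C f \<Longrightarrow> s \<in> part M C \<Longrightarrow> cf (lift f s) m = f (cf s m)"
  unfolding lift_def by (simp add: cf_coeffwise[OF C])

lemma twist_in: "s \<in> part M C \<Longrightarrow> twist \<rho> \<tau> s \<in> part M C"
  by (rule linear_operator_on_D(1)[OF twist_linear])

lemma lift_in: "linear_operator_on scale C f \<Longrightarrow> s \<in> part M C \<Longrightarrow> lift f s \<in> part M C"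
  by (rule linear_operator_on_D(1)[OF lift_linear])

lemma part_eqI: "s \<in> part M C \<Longrightarrow> t \<in> part M C \<Longrightarrow> (\<And>m. cf s m = cf t m) \<Longrightarrow> s = t"
  by (rule cf_eqD[OF part_in_Ahat part_in_Ahat]) auto

text \<open>Iterates of \<open>twist\<close> occur in the product rule of a higher derivation, and
  each application contributes one factor \<open>\<rho> powi m\<close>.\<close>

lemma twist_funpow_monomial:
  assumes "a \<in> C"
  shows "(twist \<rho> \<tau> ^^ p) (a * Y m) = scale ((\<rho> powi m) ^ p) ((\<tau> ^^ p) a) * Y m"
proof (induction p)
  case (Suc p)
  have "(\<tau> ^^ p) a \<in> C"
    by (rule linear_operator_on_D(1)[OF linear_operator_on_funpow[OF \<tau>D(1)] assms])
  then show ?case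
    using Suc by (simp add: twist_monomial C_alg \<tau>D(7) mult.commute)
qed simp

text \<open>Multiplicativity combines the commutation of \<tau> with conjugation and the additivity
  of exponents of \<rho>. Bijectivity is inherited coefficientwise from \<tau>, as the scalars are
  nonzero.\<close>

lemma twist_automorphism: "algebra_automorphism_on scale (part M C) (twist \<rho> \<tau>)"
  unfolding algebra_automorphism_on_def
proof (intro conjI ballI)
  note lin = linear_operator_on_D[OF twist_linear]
  show "linear_operator_on scale (part M C) (twist \<rho> \<tau>)" by (rule twist_linear)
  show "twist \<rho> \<tau> 1 = 1" using twist_const[OF C_alg(1)] \<tau>D(3) by simp
  show "twist \<rho> \<tau> (s * t) = twist \<rho> \<tau> s * twist \<rho> \<tau> t" if "s \<in> part M C" "t \<in> part M C" for s t
  proof (rule part_mult_induct[OF C M twist_linear, where G = "\<lambda>s t. twist \<rho> \<tau> s * twist \<rho> \<tau> t"])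
    fix a b m l assume ab: "a \<in> C" "b \<in> C"
    have "\<tau> (conj m b) = conj m (\<tau> b)"
      using conj_intertwine[OF C \<tau>D(1), of 1 b m] \<tau>\<sigma> ab by simp
    then show "twist \<rho> \<tau> (a * conj m b * Y (m + l)) = twist \<rho> \<tau> (a * Y m) * twist \<rho> \<tau> (b * Y l)"
      using ab \<rho> by (simp add: twist_monomial monomial_mult C_alg \<tau>D conj_in[OF C] conj_scale mult.commute
        scale_mult_left[symmetric] scale_mult_right[symmetric] power_int_add)
  qed (simp_all add: lin distrib_left distrib_right that)
  show "bij_betw (twist \<rho> \<tau>) (part M C) (part M C)"
    unfolding bij_betw_def
  proof
    have inj: "inj_on \<tau> C" and surj: "\<tau> ` C = C"
      using \<tau>D(2) by (auto simp: bij_betw_def)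
    show "inj_on (twist \<rho> \<tau>) (part M C)"
    proof (rule inj_onI, rule part_eqI)
      fix s t m assume st: "s \<in> part M C" "t \<in> part M C" and eq: "twist \<rho> \<tau> s = twist \<rho> \<tau> t"
      have "\<tau> (cf s m) = \<tau> (cf t m)"
        using cf_twist[OF st(1), of m] cf_twist[OF st(2), of m] \<rho> unfolding eq by simp
      then show "cf s m = cf t m"
        using inj st cf_C(1) by (auto dest: inj_onD)
    qed
    have "t \<in> twist \<rho> \<tau> ` part M C" if "t \<in> part M C" for t
      using C M that
    proof (induction rule: part_induct)
      case (monomial a m)
      obtain b where b: "b \<in> C" "a = \<tau> b" using surj monomial by blast
      \<comment> \<open>The scalar \<open>\<rho> powi (- m)\<close> in the preimage cancels the
        factor that \<open>twist\<close> introduces at exponent m.\<close>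
      have "twist \<rho> \<tau> (scale (\<rho> powi (- m)) b * Y m) = a * Y m"
        using b \<rho> by (simp add: twist_monomial C_alg \<tau>D(7) power_int_add[symmetric])
      then show ?case
        using part_monomial[OF C M C_alg(4)[OF b(1)] monomial(2)] by (metis imageI)
    next
      case (add s t)
      then obtain s' t' where "s' \<in> part M C" "t' \<in> part M C" "s + t = twist \<rho> \<tau> (s' + t')"
        using lin(2) by fastforce
      then show ?case using part_alg(2) by simp
    qed
    then show "twist \<rho> \<tau> ` part M C = part M C"
      using twist_in by blast
  qed
qed

text \<open>On monomials, moving \<delta> past \<open>conj m\<close> costs
  \<open>\<rho> powi m\<close>, exactly the scalar by which \<open>twist\<close> differs from \<tau>
  at exponent m.\<close>

lemma lift_skew_derivation:
  assumes \<delta>: "skew_derivation_on scale C \<tau> \<delta>"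
    and \<delta>\<sigma>: "\<And>a. a \<in> C \<Longrightarrow> \<delta> (\<sigma> a) = scale \<rho> (\<sigma> (\<delta> a))"
  shows "skew_derivation_on scale (part M C) (twist \<rho> \<tau>) (lift \<delta>)"
  unfolding skew_derivation_on_def
proof (intro conjI ballI)
  have lin: "linear_operator_on scale C \<delta>"
    and prod: "\<And>r s. r \<in> C \<Longrightarrow> s \<in> C \<Longrightarrow> \<delta> (r * s) = \<tau> r * \<delta> s + \<delta> r * s"
    using \<delta> by (auto simp: skew_derivation_on_def)
  note \<delta>D = linear_operator_on_D[OF lin] 
  note lift = linear_operator_on_D[OF lift_linear[OF lin]] and twist = linear_operator_on_D[OF twist_linear]
  show "linear_operator_on scale (part M C) (lift \<delta>)" by (rule lift_linear[OF lin])
  show "lift \<delta> (s * t) = twist \<rho> \<tau> s * lift \<delta> t + lift \<delta> s * t"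
    if "s \<in> part M C" "t \<in> part M C" for s t
  proof (rule part_mult_induct[OF C M lift_linear[OF lin],
        where G = "\<lambda>s t. twist \<rho> \<tau> s * lift \<delta> t + lift \<delta> s * t"])
    fix a b m l assume ab: "a \<in> C" "b \<in> C"
    have "\<delta> (conj m b) = scale (\<rho> powi m) (conj m (\<delta> b))"
      using conj_intertwine[where f = \<delta>, OF C lin \<delta>\<sigma> \<rho> ab(2)] .
    then show "lift \<delta> (a * conj m b * Y (m + l)) =
        twist \<rho> \<tau> (a * Y m) * lift \<delta> (b * Y l) + lift \<delta> (a * Y m) * (b * Y l)"
      using ab by (simp add: lift_monomial[OF lin] twist_monomial monomial_mult C_alg \<delta>D prod
        conj_in[OF C] scale_mult_left[symmetric] scale_mult_right[symmetric] distrib_right)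
  qed (simp_all add: lift twist distrib_left distrib_right that)
qed

lemma lift_q_skew:
  assumes lin: "linear_operator_on scale C \<delta>" and "q_skew_on scale C q \<tau> \<delta>"
  shows "q_skew_on scale (part M C) q (twist \<rho> \<tau>) (lift \<delta>)"
  unfolding q_skew_on_def
proof (intro conjI ballI)
  show "q \<noteq> 0" using assms(2) by (simp add: q_skew_on_def)
  fix s assume s: "s \<in> part M C"
  note in_part = s twist_in lift_in[OF lin] part_alg(4)
  have "\<delta> (\<tau> (cf s m)) = scale q (\<tau> (\<delta> (cf s m)))" for m
    using assms(2) cf_C(1)[OF s] by (simp add: q_skew_on_def)
  then show "lift \<delta> (twist \<rho> \<tau> s) = scale q (twist \<rho> \<tau> (lift \<delta> s))"
    by - (rule part_eqI, simp_all add: in_part cf_lift[OF lin] cf_twist cf_C(1)[OF s] cf_scale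
      part_in_Ahat[OF twist_in[OF lift_in[OF lin s]]] linear_operator_on_D[OF lin] \<tau>D mult.commute)
qed

text \<open>In the i-th term of the product rule for monomials,
  \<open>(\<rho> powi m) ^ (p - i)\<close> appears on both sides: from moving
  \<open>d (p - i)\<close> past \<open>conj m\<close>, and from the \<open>p - i\<close>
  applications of \<open>twist\<close>.\<close>

lemma lift_higher_skew_derivation:
  assumes d: "higher_skew_derivation_on scale C q \<tau> d"
    and d\<sigma>: "\<And>p a. a \<in> C \<Longrightarrow> d p (\<sigma> a) = scale (\<rho> ^ p) (\<sigma> (d p a))"
  shows "higher_skew_derivation_on scale (part M C) q (twist \<rho> \<tau>) (\<lambda>p. lift (d p))"
  unfolding higher_skew_derivation_on_def
proof (intro conjI allI ballI)
  have lin: "linear_operator_on scale C (d p)" and d0: "\<And>a. a \<in> C \<Longrightarrow> d 0 a = a"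
    and prod: "\<And>r s. r \<in> C \<Longrightarrow> s \<in> C \<Longrightarrow> d p (r * s) = (\<Sum>i=0..p. (\<tau> ^^ (p - i)) (d i r) * d (p - i) s)"
    and skew: "\<And>r. r \<in> C \<Longrightarrow> d p (\<tau> r) = scale (q ^ p) (\<tau> (d p r))" and "q \<noteq> 0" for p
    using d by (auto simp: higher_skew_derivation_on_def)
  note dD = linear_operator_on_D[OF lin]
  note lift = linear_operator_on_D[OF lift_linear[OF lin]]
    and twist = linear_operator_on_D[OF twist_linear]
    and twists = linear_operator_on_D[OF linear_operator_on_funpow[OF twist_linear]]
  show "q \<noteq> 0" by fact
  show "linear_operator_on scale (part M C) (lift (d p))" for p by (rule lift_linear[OF lin])
  show "lift (d 0) s = s" if "s \<in> part M C" for s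
    using that by - (rule part_eqI, simp_all add: lift_in[OF lin] cf_lift[OF lin] d0 cf_C(1))
  \<comment> \<open>For each fixed p the commutation of \<open>d p\<close> with \<tau> is an
    ordinary skew condition with parameter \<open>q ^ p\<close>, so the result for a single operator
    applies.\<close>
  have "q_skew_on scale C (q ^ p) \<tau> (d p)" for p
    using skew[of _ p] \<open>q \<noteq> 0\<close> by (simp add: q_skew_on_def)
  from lift_q_skew[OF lin this]
  show "lift (d p) (twist \<rho> \<tau> s) = scale (q ^ p) (twist \<rho> \<tau> (lift (d p) s))" if "s \<in> part M C" for p s
    using that by (simp add: q_skew_on_def)
  fix p s t assume s: "s \<in> part M C" and t: "t \<in> part M C"
  let ?G = "\<lambda>s t. \<Sum>i=0..p. (twist \<rho> \<tau> ^^ (p - i)) (lift (d i) s) * lift (d (p - i)) t"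
  show "lift (d p) (s * t) = ?G s t"
  proof (rule part_mult_induct[where F = "lift (d p)" and G = ?G and s = s and t = t,
        OF C M lift_linear[OF lin] _ _ _ s t])
    fix a b m l assume ab: "a \<in> C" "b \<in> C"
    have conj: "d j (conj m b) = scale ((\<rho> powi m) ^ j) (conj m (d j b))" for j
      using conj_intertwine[OF C lin d\<sigma> _ ab(2), of j m] \<rho>
      by (simp add: power_int_power power_int_power' mult.commute)
    show "lift (d p) (a * conj m b * Y (m + l)) =
        (\<Sum>i=0..p. (twist \<rho> \<tau> ^^ (p - i)) (lift (d i) (a * Y m)) * lift (d (p - i)) (b * Y l))"
      using ab by (simp add: lift_monomial[OF lin] twist_funpow_monomial monomial_mult C_alg dD prod
        conj_in[OF C] conj scale_mult_left[symmetric] scale_mult_right[symmetric] sum_distrib_right)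
  next
    fix r r' u assume "r \<in> part M C" "r' \<in> part M C" "u \<in> part M C"
    then show "?G (r + r') u = ?G r u + ?G r' u"
      unfolding sum.distrib[symmetric] distrib_right[symmetric]
      by (intro sum.cong refl) (simp only: lift(1,2) twists(2))
  next
    fix r u u' assume "r \<in> part M C" "u \<in> part M C" "u' \<in> part M C"
    then show "?G r (u + u') = ?G r u + ?G r u'"
      unfolding sum.distrib[symmetric] distrib_left[symmetric]
      by (intro sum.cong refl) (simp only: lift(2))
  qed
qed

lemma lift_iterative:
  assumes lin: "\<And>p. linear_operator_on scale C (d p)" and "iterative_on scale C q d"
  shows "iterative_on scale (part M C) q (\<lambda>p. lift (d p))"
  unfolding iterative_on_def
proof (intro allI ballI)
  fix i j s assume s: "s \<in> part M C"
  note in_part = s lift_in[OF lin] part_alg(4)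
  have "d i (d j (cf s m)) = scale (q_binomial (i + j) j q) (d (i + j) (cf s m))" for m
    using assms(2) cf_C(1)[OF s] by (simp add: iterative_on_def)
  then show "lift (d i) (lift (d j) s) = scale (q_binomial (i + j) j q) (lift (d (i + j)) s)"
    by - (rule part_eqI, simp_all add: in_part cf_lift[OF lin] cf_scale
      part_in_Ahat[OF lift_in[OF lin s]])
qed

text \<open>An element has finitely many coefficients, so a common bound exists; in the induction
  the bounds of two summands combine by \<open>max\<close>.\<close>

lemma lift_locally_nilpotent:
  assumes lin: "\<And>p. linear_operator_on scale C (d p)" and nil: "locally_nilpotent_on C d"
  shows "locally_nilpotent_on (part M C) (\<lambda>p. lift (d p))"
  unfolding locally_nilpotent_on_def
proof
  fix s assume s: "s \<in> part M C"
  from C M s show "\<exists>m. \<forall>i\<ge>m. lift (d i) s = 0"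
  proof (induction rule: part_induct)
    case (monomial a m)
    then show ?case using nil unfolding locally_nilpotent_on_def
      by (auto simp: lift_monomial[OF lin]) (metis mult_zero_left)
  next
    case (add s t)
    then obtain m l where "\<forall>i\<ge>m. lift (d i) s = 0" "\<forall>i\<ge>l. lift (d i) t = 0" by auto
    then have "\<forall>i\<ge>max m l. lift (d i) (s + t) = 0"
      using linear_operator_on_D(2)[OF lift_linear[OF lin] add(1,2)] by simp
    then show ?case by blast
  qed
qed

end

subsection \<open>Interchanging the two kinds of extension\<close>

lemma conj_mult: "conj m (a * b) = conj m a * conj m b"
proof -
  have "conj m a * conj m b = Y m * a * (Y (- m) * Y m) * b * Y (- m)"
    unfolding conj_def by (simp only: mult.assoc)
  then show ?thesis by (simp add: conj_def mult.assoc)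
qed

text \<open>Used with the new variable as \<open>z\<close>: it allows powers of y and powers of
  \<open>z\<close> to be interchanged up to a scalar.\<close>

lemma conj_eigenvector:
  assumes "z \<in> N" "\<sigma> z = scale \<mu> z" "\<mu> \<noteq> 0"
  shows "conj m z = scale (\<mu> powi m) z"
proof -
  have up: "conj 1 z = scale \<mu> z" using conj_1[OF assms(1)] assms(2) by simp
  then have "conj (- 1) (scale \<mu> z) = z"
    using conj_conj[of "- 1" 1 z] by simp
  then have "scale (inverse \<mu>) (scale \<mu> (conj (- 1) z)) = scale (inverse \<mu>) z"
    by (simp only: conj_scale)
  then have down: "conj (- 1) z = scale (inverse \<mu>) z" using assms(3) by simp
  show ?thesis
  proof (induction m rule: int_induct[where k = 0])
    case (step1 m)
    have "conj (m + 1) z = conj 1 (conj m z)" by (simp add: conj_conj add.commute)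
    then show ?case using step1 assms(3) by (simp add: conj_scale up power_int_add)
  next
    case (step2 m)
    have "conj (m - 1) z = conj (- 1) (conj m z)" by (simp add: conj_conj)
    then show ?case using step2 assms(3) by (simp add: conj_scale down power_int_diff divide_inverse)
  qed simp
qed

text \<open>\<open>\<sigma> (z * a)\<close> is computed twice: as \<mu> times
  \<open>z * \<sigma> a\<close>, and by applying \<sigma> to
  \<open>\<tau> a * z + \<delta> a\<close>. After division by \<mu>, both are polynomials of degree
  at most one in \<open>z\<close> over \<open>C\<close>, and their coefficients agree.\<close>

lemma skew_poly_ring_commutes:
  assumes S: "skew_poly_ring scale C z \<tau> \<delta> S" and "S \<subseteq> N" and C: "\<sigma> ` C = C"
    and z: "\<sigma> z = scale \<mu> z" "\<mu> \<noteq> 0" and a: "a \<in> C"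
  shows "\<tau> (\<sigma> a) = \<sigma> (\<tau> a)" "\<delta> (\<sigma> a) = scale (inverse \<mu>) (\<sigma> (\<delta> a))"
proof -
  note SD = skew_poly_ringD[OF S]
  have lin: "linear_operator_on scale C \<delta>" using SD(3) by (simp add: skew_derivation_on_def)
  note \<tau> = linear_operator_on_D[OF automorphism_onD(1)[OF SD(2)]] and \<delta> = linear_operator_on_D[OF lin]
  note \<sigma> = automorphism_onD(4)[OF \<sigma>_automorphism] linear_operator_on_D[OF automorphism_onD(1)[OF \<sigma>_automorphism]]
  have \<sigma>C: "\<sigma> b \<in> C" if "b \<in> C" for b using C that by blast
  have mem: "a \<in> N" "z \<in> N" "\<tau> a \<in> N" "\<delta> a \<in> N"
    using a \<tau>(1)[OF a] \<delta>(1)[OF a] SD(5,6) \<open>S \<subseteq> N\<close> by auto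
  have "\<sigma> (z * a) = scale \<mu> (z * \<sigma> a)"
    by (simp add: \<sigma>(1) mem z(1) scale_mult_left)
  also have "\<dots> = scale \<mu> (\<tau> (\<sigma> a) * z + \<delta> (\<sigma> a))"
    by (simp add: SD(7)[OF \<sigma>C[OF a]])
  finally have 1: "\<sigma> (z * a) = scale \<mu> (\<tau> (\<sigma> a) * z + \<delta> (\<sigma> a))" .
  have "\<sigma> (z * a) = \<sigma> (\<tau> a * z + \<delta> a)" by (simp add: SD(7)[OF a])
  also have "\<dots> = scale \<mu> (\<sigma> (\<tau> a) * z) + \<sigma> (\<delta> a)"
    by (simp add: \<sigma> mem N z(1) scale_mult_right)
  finally have "scale (inverse \<mu>) (scale \<mu> (\<tau> (\<sigma> a) * z + \<delta> (\<sigma> a))) =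
      scale (inverse \<mu>) (scale \<mu> (\<sigma> (\<tau> a) * z) + \<sigma> (\<delta> a))"
    using 1 by simp
  then have eq: "\<tau> (\<sigma> a) * z + \<delta> (\<sigma> a) = \<sigma> (\<tau> a) * z + scale (inverse \<mu>) (\<sigma> (\<delta> a))"
    using z(2) by (simp add: scale_right_distrib)
  have "\<tau> (\<sigma> a) \<in> C" "\<delta> (\<sigma> a) \<in> C" "\<sigma> (\<tau> a) \<in> C" "scale (inverse \<mu>) (\<sigma> (\<delta> a)) \<in> C"
    using \<sigma>C \<tau>(1) \<delta>(1) a subalgebraD(4)[OF SD(1)] by auto
  from skew_poly_ring_linear_unique[OF S this(1,2,3,4) eq]
  show "\<tau> (\<sigma> a) = \<sigma> (\<tau> a)" "\<delta> (\<sigma> a) = scale (inverse \<mu>) (\<sigma> (\<delta> a))" .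
qed

text \<open>An element is expanded in powers of y over \<open>S\<close>, and each coefficient in
  powers of \<open>z\<close> over \<open>C\<close>; interchanging the two sums costs only nonzero
  scalars. Existence and uniqueness for powers of \<open>z\<close> over \<open>part M C\<close> thus
  reduce to those of \<open>S\<close> over \<open>C\<close>.\<close>

lemma part_skew_poly_ring:
  assumes S: "skew_poly_ring scale C z \<tau> \<delta> S" and stab: "stable C" "stable S" and M: "exponents M"
    and z: "\<sigma> z = scale \<mu> z" and \<mu>: "\<mu> \<noteq> 0"
  shows "skew_poly_ring scale (part M C) z (twist (inverse \<mu>) \<tau>) (lift \<delta>) (part M S)"
proof -
  note SD = skew_poly_ringD[OF S]
  note S_alg = subalgebraD[OF SD(4)] and C_alg = subalgebraD[OF SD(1)]
  have SN: "S \<subseteq> N" and C\<sigma>: "\<sigma> ` C = C" and zN: "z \<in> N" and CN: "C \<subseteq> N"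
    using stab SD(6) by (auto simp: stable_def)
  note comm = skew_poly_ring_commutes[OF S SN C\<sigma> z \<mu>]
  have \<rho>: "inverse \<mu> \<noteq> 0" using \<mu> by simp
  have lin: "linear_operator_on scale C \<delta>" using SD(3) by (simp add: skew_derivation_on_def)
  note \<tau> = linear_operator_on_D[OF automorphism_onD(1)[OF SD(2)]]
  note pC = subalgebraD[OF part_subalgebra[OF stab(1) M]]
  note tw = twist_monomial[OF stab(1) M \<rho> SD(2) comm(1)] and li = lift_monomial[OF stab(1) M \<rho> SD(2) comm(1) lin]
  note tw_lin = linear_operator_on_D[OF twist_linear[OF stab(1) M \<rho> SD(2) comm(1)]]
  note li_lin = linear_operator_on_D[OF lift_linear[OF stab(1) M \<rho> SD(2) comm(1) lin]]
  have sub: "part M C \<subseteq> part M S" by (rule part_mono[OF SD(5)])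
  have z_part: "z \<in> part M S" by (rule part_const[OF stab(2) M SD(6)])
  have conj_z: "conj m (z ^ k) = scale ((\<mu> powi m) ^ k) (z ^ k)" for m k
    by (induction k)
      (simp_all add: conj_mult conj_eigenvector[OF zN z \<mu>] scale_mult_left scale_mult_right[symmetric] mult.commute,
       simp add: conj_def)
  have mono_z: "(a * Y m) * z ^ k = scale ((\<mu> powi m) ^ k) (a * z ^ k) * Y m" for a m k
    using monomial_mult[of a m "z ^ k" 0] by (simp add: conj_z scale_mult_right[symmetric] scale_mult_left)
  have powN: "a * z ^ k \<in> N" if "a \<in> C" for a k
    using that CN by (auto intro!: N(3) subalgebra_power[OF N_subalgebra zN])
  \<comment> \<open>Right multiplication by \<open>z ^ k\<close> does not mix exponents of y: the
    m-th coefficient is multiplied by \<open>z ^ k\<close> and rescaled.\<close>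
  have cf_z: "cf (b * z ^ k) m = scale ((\<mu> powi m) ^ k) (cf b m * z ^ k)" if "b \<in> part M C" for b k m
    using stab(1) M that
  proof (induction rule: part_induct)
    case (monomial a l)
    then have "a \<in> N" using CN by auto
    then show ?case using monomial powN[of a k]
      unfolding mono_z by (simp add: cf_monomial N)
  next
    case (add s t)
    have "z ^ k \<in> Ahat" using subalgebra_power[OF N_subalgebra zN] N_subset by auto
    then have "s * z ^ k \<in> Ahat" "t * z ^ k \<in> Ahat" "s \<in> Ahat" "t \<in> Ahat"
      using part_in_Ahat[OF add(1)] part_in_Ahat[OF add(2)] by (auto intro: Ahat)
    then show ?case using add(3,4) by (simp add: distrib_right cf_add scale_right_distrib)
  qed
  have commute: "z * s = twist (inverse \<mu>) \<tau> s * z + lift \<delta> s" if "s \<in> part M C" for s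
    using stab(1) M that
  proof (induction rule: part_induct)
    case (monomial a m)
    have "z * (a * Y m) = (\<tau> a * z + \<delta> a) * Y m"
      by (simp add: SD(7)[OF monomial(1)] mult.assoc[symmetric])
    \<comment> \<open>Moving \<open>z\<close> to the right of \<open>Y m\<close> creates
      \<open>\<mu> powi m\<close>, which the scalar of \<open>twist\<close> cancels.\<close>
    also have "\<dots> = (scale (inverse \<mu> powi m) (\<tau> a) * Y m) * z ^ 1 + \<delta> a * Y m"
      unfolding mono_z using \<mu>
      by (simp add: distrib_right scale_mult_left[symmetric] power_int_inverse)
    finally show ?case using monomial by (simp add: tw li)
  next
    case (add s t)
    then show ?case by (simp add: distrib_left distrib_right tw_lin li_lin)
  qed
  have exists: "\<exists>F c. finite F \<and> (\<forall>k. c k \<in> part M C) \<and> (\<forall>k. k \<notin> F \<longrightarrow> c k = 0) \<and> s = (\<Sum>k\<in>F. c k * z ^ k)"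
    if "s \<in> part M S" for s
    using stab(2) M that
  proof (induction rule: part_induct)
    case (monomial a m)
    obtain c :: "nat \<Rightarrow> 'a" where c: "range c \<subseteq> C" "finite {k. c k \<noteq> 0}" "a = (\<Sum>k | c k \<noteq> 0. c k * z ^ k)"
      using SD(8) monomial(1) by blast
    \<comment> \<open>The scalar compensates for \<open>(\<mu> powi m) ^ k\<close>, which arises
      when \<open>Y m\<close> passes \<open>z ^ k\<close>.\<close>
    let ?c = "\<lambda>k. scale ((inverse \<mu> powi m) ^ k) (c k) * Y m"
    have eq: "?c k * z ^ k = c k * z ^ k * Y m" for k
      unfolding mono_z using \<mu>
      by (simp add: scale_mult_left[symmetric] power_int_inverse power_inverse)
    show ?case
    proof (intro exI conjI allI impI)
      show "finite {k. c k \<noteq> 0}" by fact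
      show "?c k \<in> part M C" for k
        using c(1) monomial(2) by (intro part_monomial[OF stab(1) M] C_alg(4)) auto
      show "a * Y m = (\<Sum>k | c k \<noteq> 0. ?c k * z ^ k)"
        unfolding eq by (simp add: c(3) sum_distrib_right)
    qed auto
  next
    case (add s t)
    obtain F :: "nat set" and c :: "nat \<Rightarrow> 'a" where
      c: "finite F" "\<And>k. c k \<in> part M C" "\<And>k. k \<notin> F \<Longrightarrow> c k = 0" "s = (\<Sum>k\<in>F. c k * z ^ k)"
      using add(3) by blast
    obtain G :: "nat set" and d :: "nat \<Rightarrow> 'a" where
      d: "finite G" "\<And>k. d k \<in> part M C" "\<And>k. k \<notin> G \<Longrightarrow> d k = 0" "t = (\<Sum>k\<in>G. d k * z ^ k)"
      using add(4) by blast
    have "s = (\<Sum>k\<in>F \<union> G. c k * z ^ k)"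
      unfolding c(4) by (rule sum.mono_neutral_left) (use c d in auto)
    moreover have "t = (\<Sum>k\<in>F \<union> G. d k * z ^ k)"
      unfolding d(4) by (rule sum.mono_neutral_left) (use c d in auto)
    ultimately have "s + t = (\<Sum>k\<in>F \<union> G. (c k + d k) * z ^ k)"
      by (simp add: sum.distrib distrib_right)
    then show ?case
      using c d by (intro exI[of _ "F \<union> G"] exI[of _ "\<lambda>k. c k + d k"]) (simp add: pC(2))
  qed
  have unique: "c = d"
    if fin: "finite F" and c: "\<And>k. c k \<in> part M C" and d: "\<And>k. d k \<in> part M C"
      and cF: "\<And>k. k \<notin> F \<Longrightarrow> c k = 0" and dF: "\<And>k. k \<notin> F \<Longrightarrow> d k = 0"
      and eq: "(\<Sum>k\<in>F. c k * z ^ k) = (\<Sum>k\<in>F. d k * z ^ k)" for F :: "nat set" and c d :: "nat \<Rightarrow> 'a"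
  proof
    fix k
    have zk: "z ^ k \<in> Ahat" for k using subalgebra_power[OF N_subalgebra zN] N_subset by auto
    let ?b = "\<lambda>c m k. scale ((\<mu> powi m) ^ k) (cf (c k) m)"
    have cf: "cf (\<Sum>k\<in>F. c k * z ^ k) m = (\<Sum>k\<in>F. ?b c m k * z ^ k)"
      if "\<And>k. c k \<in> part M C" for c :: "nat \<Rightarrow> 'a" and m
      using cf_sum_distrib[of F "\<lambda>k. c k * z ^ k"] part_in_Ahat[OF that] zk
      by (simp add: Ahat(3) cf_z that scale_mult_left)
    \<comment> \<open>For fixed m both families are coefficients over \<open>C\<close> of one
      element of \<open>S\<close>, so freeness of \<open>S\<close> decides; afterwards the nonzero
      powers of \<mu> cancel.\<close>
    have "?b c m = ?b d m" for m
    proof (rule unique_coefficients[OF SD(8) fin])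
      show "(\<Sum>k\<in>F. ?b c m k * z ^ k) \<in> S"
        using part_cf[OF c] SD(5) subalgebra_power[OF SD(4,6)]
        by (intro subalgebra_sum[OF SD(4)] S_alg(3,4)) auto
      show "(\<Sum>k\<in>F. ?b c m k * z ^ k) = (\<Sum>k\<in>F. ?b d m k * z ^ k)"
        using cf[of c m, OF c] cf[of d m, OF d] eq by simp
    qed (auto simp: cF dF cf_zero intro!: C_alg(4) part_cf c d)
    then have "?b c m k = ?b d m k" for m by (rule fun_cong)
    then have "cf (c k) = cf (d k)" using \<mu> by auto
    then show "c k = d k" by (rule cf_eqD[OF part_in_Ahat[OF c] part_in_Ahat[OF d]])
  qed
  have "\<forall>s\<in>part M S. \<exists>!c :: nat \<Rightarrow> 'a. range c \<subseteq> part M C \<and> finite {k. c k \<noteq> 0} \<and>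
      s = (\<Sum>k | c k \<noteq> 0. c k * z ^ k)"
  proof (intro ballI ex1_coefficientsI)
    fix F :: "nat set" and c d :: "nat \<Rightarrow> 'a" and s
    assume *: "finite F" "\<And>k. c k \<in> part M C" "\<And>k. d k \<in> part M C" "\<And>k. k \<notin> F \<Longrightarrow> c k = 0"
      "\<And>k. k \<notin> F \<Longrightarrow> d k = 0" "s = (\<Sum>k\<in>F. c k * z ^ k)" "s = (\<Sum>k\<in>F. d k * z ^ k)"
    show "c = d" by (rule unique[OF *(1-5) trans[OF *(6)[symmetric] *(7)]])
  qed (rule exists)
  then show ?thesis
    unfolding skew_poly_ring_def
    using part_subalgebra[OF stab(1) M] part_subalgebra[OF stab(2) M] sub z_part commute
      twist_automorphism[OF stab(1) M \<rho> SD(2) comm(1)]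
      lift_skew_derivation[OF stab(1) M \<rho> SD(2) comm(1) SD(3) comm(2)]
    by auto
qed

section \<open>The rings obtained by adjoining y, and their generators\<close>

lemma stable_automorphism:
  assumes "stable R"
  shows "algebra_automorphism_on scale R \<sigma>"
proof -
  note \<sigma> = automorphism_onD[OF \<sigma>_automorphism]
  have "inj_on \<sigma> R" using \<sigma>(2) stableD(2)[OF assms] by (auto simp: bij_betw_def intro: inj_on_subset)
  then have "bij_betw \<sigma> R R" using stableD(3)[OF assms] by (simp add: bij_betw_def)
  then show ?thesis
    using \<sigma> linear_operator_on_D[OF \<sigma>(1)] stableD(2,3)[OF assms]
    unfolding algebra_automorphism_on_def linear_operator_on_def by (auto simp: subset_iff)
qed

lemma y_in_part: "stable C \<Longrightarrow> exponents M \<Longrightarrow> 1 \<in> M \<Longrightarrow> y \<in> part M C"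
  using part_monomial[of C M 1 1] subalgebraD(1)[OF stableD(1)] by (simp add: Y_1)

lemma yi_in_part: "stable C \<Longrightarrow> exponents M \<Longrightarrow> - 1 \<in> M \<Longrightarrow> yi \<in> part M C"
  using part_monomial[of C M 1 "- 1"] subalgebraD(1)[OF stableD(1)] by (simp add: Y_minus_1)

text \<open>The expansion is already available with integer exponents; what remains is the
  translation between natural and nonnegative integer indices.\<close>

lemma part_skew_poly_ring_y:
  assumes R: "stable R"
  shows "skew_poly_ring scale R y \<sigma> (\<lambda>_. 0) (part {0..} R)"
proof -
  note R_alg = subalgebraD[OF stableD(1)[OF R]]
  have reindex: "(\<Sum>k\<in>F. c (int k) * y ^ k) = (\<Sum>m\<in>int ` F. c m * Y m)" for F and c :: "int \<Rightarrow> 'a"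
    by (simp add: sum.reindex Y_of_nat)
  have "\<exists>!c :: nat \<Rightarrow> 'a. range c \<subseteq> R \<and> finite {k. c k \<noteq> 0} \<and> s = (\<Sum>k | c k \<noteq> 0. c k * y ^ k)"
    if s: "s \<in> part {0..} R" for s
  proof (rule ex1_coefficientsI)
    \<comment> \<open>All exponents in the support are nonnegative, so \<open>int\<close> recovers
      them from their images under \<open>nat\<close>.\<close>
    let ?F = "nat ` {m. cf s m \<noteq> 0}"
    have fin: "finite ?F" using cf_finite[OF part_in_Ahat[OF s]] by simp
    have zero: "cf s m = 0" if "m \<notin> int ` ?F" for m
      using that part_cf_zero[OF s, of m] by (force simp: image_image)
    have "s = (\<Sum>k\<in>?F. cf s (int k) * y ^ k)"
      unfolding reindex
      by (rule cf_sum_superset[symmetric, OF part_in_Ahat[OF s] finite_imageI[OF fin] zero])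
    moreover have "\<forall>k. k \<notin> ?F \<longrightarrow> cf s (int k) = 0"
      by (intro allI impI zero) (simp only: inj_image_mem_iff[OF inj_of_nat] not_False_eq_True)
    ultimately show "\<exists>F c. finite F \<and> (\<forall>k. c k \<in> R) \<and> (\<forall>k. k \<notin> F \<longrightarrow> c k = 0) \<and>
        s = (\<Sum>k\<in>F. c k * y ^ k)"
      using fin part_cf[OF s] by (intro exI[of _ ?F] exI[of _ "\<lambda>k. cf s (int k)"]) blast
  next
    fix F :: "nat set" and c d :: "nat \<Rightarrow> 'a"
    have cf: "cf s (int k) = c k"
      if fin: "finite F" and c: "\<And>k. c k \<in> R" "\<And>k. k \<notin> F \<Longrightarrow> c k = 0" "s = (\<Sum>k\<in>F. c k * y ^ k)"
      for c :: "nat \<Rightarrow> 'a" and k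
    proof -
      \<comment> \<open>Extension by 0 to negative exponents turns a polynomial expansion into a
        Laurent one, whose coefficients are known to be unique.\<close>
      let ?c = "\<lambda>m. if m \<ge> 0 then c (nat m) else 0"
      have "s = (\<Sum>m\<in>int ` F. ?c m * Y m)"
        unfolding reindex[symmetric] using c(3) by simp
      moreover have "?c m = 0" if "m \<notin> int ` F" for m
        using that c(2) by (cases m) auto
      ultimately have "cf s = ?c"
        using fin c(1) stableD(2)[OF R] N(5) by (intro cf_eqI(1)[of "int ` F"]) auto
      then show ?thesis by simp
    qed
    assume "finite F" "\<And>m. c m \<in> R" "\<And>m. d m \<in> R" "\<And>m. m \<notin> F \<Longrightarrow> c m = 0" "\<And>m. m \<notin> F \<Longrightarrow> d m = 0"
      "s = (\<Sum>m\<in>F. c m * y ^ m)" "s = (\<Sum>m\<in>F. d m * y ^ m)"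
    then show "c = d" using cf[of c] cf[of d] by (intro ext) metis
  qed
  moreover have "skew_derivation_on scale R \<sigma> (\<lambda>_. 0)"
    using R_alg(5) by (auto simp: skew_derivation_on_def linear_operator_on_def)
  ultimately show ?thesis
    unfolding skew_poly_ring_def
    using stableD[OF R] stable_automorphism[OF R] part_subalgebra[OF R exponents_nonneg]
      part_const[OF R exponents_nonneg] y_in_part[OF R exponents_nonneg] y_mult
    by auto
qed

lemma part_skew_laurent_ring:
  assumes R: "stable R"
  shows "skew_laurent_ring scale R y yi \<sigma> (part UNIV R)"
proof -
  have "\<exists>!c :: int \<Rightarrow> 'a. range c \<subseteq> R \<and> finite {k. c k \<noteq> 0} \<and> s = (\<Sum>k | c k \<noteq> 0. c k * Y k)"
    if s: "s \<in> part UNIV R" for s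
  proof (rule ex1_coefficientsI)
    show "\<exists>F c. finite F \<and> (\<forall>k. c k \<in> R) \<and> (\<forall>k. k \<notin> F \<longrightarrow> c k = 0) \<and> s = (\<Sum>k\<in>F. c k * Y k)"
      using part_cf[OF s] cf_finite[OF part_in_Ahat[OF s]] cf_sum[OF part_in_Ahat[OF s]]
      by (intro exI[of _ "{m. cf s m \<noteq> 0}"] exI[of _ "cf s"]) auto
  next
    fix F :: "int set" and c d :: "int \<Rightarrow> 'a"
    assume *: "finite F" "\<And>m. c m \<in> R" "\<And>m. d m \<in> R" "\<And>m. m \<notin> F \<Longrightarrow> c m = 0" "\<And>m. m \<notin> F \<Longrightarrow> d m = 0"
      "s = (\<Sum>m\<in>F. c m * Y m)" "s = (\<Sum>m\<in>F. d m * Y m)"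
    have "cf s = c" "cf s = d"
      by (rule cf_eqI(1)[OF *(1)]; use * stableD(2)[OF R] in blast)+
    then show "c = d" by simp
  qed
  then show ?thesis
    unfolding skew_laurent_ring_def
    using stableD[OF R] stable_automorphism[OF R] part_subalgebra[OF R exponents_UNIV]
      part_const[OF R exponents_UNIV] y_in_part[OF R exponents_UNIV] yi_in_part[OF R exponents_UNIV]
      y_mult y_yi yi_y
    by auto
qed

lemma part_minimal:
  assumes "stable C" "exponents M" "subalgebra scale D" "C \<subseteq> D" "\<And>m. m \<in> M \<Longrightarrow> Y m \<in> D"
  shows "part M C \<subseteq> D"
proof
  note D = subalgebraD[OF assms(3)]
  fix s assume "s \<in> part M C"
  with assms(1,2) show "s \<in> D"
    by (induction rule: part_induct) (use assms(4,5) in \<open>auto intro: D\<close>)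
qed

lemma part_UNIV_N: "part UNIV N = Ahat"
  by (auto simp: part_def cf_in)

lemma stable_N: "stable N"
  using N_subalgebra automorphism_onD(2)[OF \<sigma>_automorphism] by (simp add: stable_def bij_betw_def)

text \<open>\<open>A\<close> is given by its own freeness property in the same ambient algebra. Both
  sides are the smallest subalgebra containing \<open>N\<close> and y, so they coincide.\<close>

lemma part_nonneg_N:
  assumes "skew_poly_ring scale N y \<sigma> (\<lambda>_. 0) A"
  shows "part {0..} N = A"
proof
  note A = skew_poly_ringD[OF assms]
  show "A \<subseteq> part {0..} N"
    using part_const[OF stable_N exponents_nonneg] y_in_part[OF stable_N exponents_nonneg]
    by (intro skew_poly_ring_minimal[OF assms part_subalgebra[OF stable_N exponents_nonneg]]) auto
  show "part {0..} N \<subseteq> A"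
    using A(4,5,6) by (intro part_minimal[OF stable_N exponents_nonneg]) (auto intro: Y_in_subalgebra)
qed

end

theorem lemma4p2:
  fixes scale :: "'k::field \<Rightarrow> 'a::{ring,monoid_mult} \<Rightarrow> 'a"
    and R A Ahat :: "'a set"
    and n :: nat
    and x :: "nat \<Rightarrow> 'a"
    and \<tau> \<delta> :: "nat \<Rightarrow> 'a \<Rightarrow> 'a"
    and Aj B Bhat :: "nat \<Rightarrow> 'a set"
    and y yi :: 'a
    and \<sigma> :: "'a \<Rightarrow> 'a"
    and lam :: "nat \<Rightarrow> 'k"
  assumes "k_algebra scale"
    and "iterated_skew_poly_ring scale R n x \<tau> \<delta> Aj"
    and "skew_poly_ring scale (Aj n) y \<sigma> (\<lambda>_. 0) A"
    and "skew_laurent_ring scale (Aj n) y yi \<sigma> Ahat"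
    and "\<sigma> ` R = R"
    and "\<And>i. i \<in> {1..n} \<Longrightarrow> lam i \<noteq> 0 \<and> \<sigma> (x i) = scale (lam i) (x i)"
    and "\<And>j. B j = subalgebra scale hull (R \<union> {y} \<union> x ` {1..j})"
    and "\<And>j. Bhat j = subalgebra scale hull (R \<union> {y, yi} \<union> x ` {1..j})"
  shows "\<exists>\<tau>' \<delta>' :: nat \<Rightarrow> 'a \<Rightarrow> 'a.
    (skew_poly_ring scale R y \<sigma> (\<lambda>_. 0) (B 0) \<and>
     iterated_skew_poly_ring scale (B 0) n x \<tau>' \<delta>' B \<and> B n = A \<and>
     skew_laurent_ring scale R y yi \<sigma> (Bhat 0) \<and>
     iterated_skew_poly_ring scale (Bhat 0) n x \<tau>' \<delta>' Bhat \<and> Bhat n = Ahat \<and>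
     (\<forall>i\<in>{1..n}.
        (\<forall>j\<le>i - 1. \<forall>a\<in>Aj j. \<tau>' i a = \<tau> i a \<and> \<delta>' i a = \<delta> i a) \<and>
        \<tau>' i y = scale (inverse (lam i)) y \<and> \<delta>' i y = 0)) \<and>
    (\<forall>i\<in>{1..n}. \<forall>q. q_skew_on scale (Aj (i - 1)) q (\<tau> i) (\<delta> i) \<longrightarrow>
        q_skew_on scale (B (i - 1)) q (\<tau>' i) (\<delta>' i) \<and>
        q_skew_on scale (Bhat (i - 1)) q (\<tau>' i) (\<delta>' i)) \<and>
    (\<forall>(q :: nat \<Rightarrow> 'k) (d :: nat \<Rightarrow> nat \<Rightarrow> 'a \<Rightarrow> 'a).
        (\<forall>i\<in>{1..n}.
           higher_skew_derivation_on scale (Aj (i - 1)) (q i) (\<tau> i) (d i) \<and>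
           extends_to_on (Aj (i - 1)) (\<delta> i) (d i) \<and>
           (\<forall>p. \<forall>a\<in>Aj (i - 1). \<sigma> (d i p a) = scale (lam i ^ p) (d i p (\<sigma> a)))) \<longrightarrow>
        (\<exists>d' :: nat \<Rightarrow> nat \<Rightarrow> 'a \<Rightarrow> 'a. \<forall>i\<in>{1..n}.
           higher_skew_derivation_on scale (Bhat (i - 1)) (q i) (\<tau>' i) (d' i) \<and>
           extends_to_on (Bhat (i - 1)) (\<delta>' i) (d' i) \<and>
           (\<forall>p. \<forall>j<i. \<forall>a\<in>Aj j. d' i p a = d i p a) \<and>
           (\<forall>p\<ge>1. d' i p y = 0) \<and>
           higher_skew_derivation_on scale (B (i - 1)) (q i) (\<tau>' i) (d' i) \<and>
           (iterative_on scale (Aj (i - 1)) (q i) (d i) \<longrightarrow>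
              iterative_on scale (Bhat (i - 1)) (q i) (d' i)) \<and>
           (locally_nilpotent_on (Aj (i - 1)) (d i) \<longrightarrow>
              locally_nilpotent_on (Bhat (i - 1)) (d' i))))"
proof -
  interpret skew_laurent scale "Aj n" y yi \<sigma> Ahat
    using assms(1,4) by (simp add: skew_laurent_def skew_laurent_axioms_def)
  note iter = assms(2)
  note A_skew = assms(3) and \<sigma>R = assms(5) and x = assms(6)
  note step = iterated_skew_poly_ringD(2)[OF iter]
  have stab: "stable (Aj j)" if "j \<le> n" for j
    unfolding stable_def
    using iterated_skew_poly_ringD(4)[OF iter that] iterated_skew_poly_ring_mono[OF iter that order_refl]
      iterated_skew_poly_ring_invariant[OF iter \<sigma>_automorphism \<sigma>R x that] by blast
  have hull: "subalgebra scale hull (R \<union> Z \<union> x ` {1..j}) = part M (Aj j)"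
    if "j \<le> n" and M: "exponents M" and Z: "Z \<subseteq> part M (Aj j)"
      and Y: "\<And>D m. subalgebra scale D \<Longrightarrow> Z \<subseteq> D \<Longrightarrow> m \<in> M \<Longrightarrow> Y m \<in> D" for j Z M
  proof (rule hull_unique)
    show "R \<union> Z \<union> x ` {1..j} \<subseteq> part M (Aj j)"
      using Z iterated_skew_poly_ring_generators[OF iter \<open>j \<le> n\<close>]
        part_const[OF stab[OF \<open>j \<le> n\<close>] M] by blast
    show "subalgebra scale (part M (Aj j))" by (rule part_subalgebra[OF stab[OF \<open>j \<le> n\<close>] M])
    fix D assume "R \<union> Z \<union> x ` {1..j} \<subseteq> D" "subalgebra scale D"
    then show "part M (Aj j) \<subseteq> D"
      by (intro part_minimal[OF stab[OF \<open>j \<le> n\<close>] M] Y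
          iterated_skew_poly_ring_minimal[OF iter _ _ _ \<open>j \<le> n\<close>]) auto
  qed
  have B: "B j = part {0..} (Aj j)" if "j \<le> n" for j
    unfolding assms(7)
  proof (rule hull[OF that exponents_nonneg])
    show "{y} \<subseteq> part {0..} (Aj j)" using y_in_part[OF stab[OF that] exponents_nonneg] by simp
  qed (auto intro: Y_in_subalgebra)
  have Bhat: "Bhat j = part UNIV (Aj j)" if "j \<le> n" for j
    unfolding assms(8)
  proof (rule hull[OF that exponents_UNIV])
    show "{y, yi} \<subseteq> part UNIV (Aj j)"
      using y_in_part[OF stab[OF that] exponents_UNIV] yi_in_part[OF stab[OF that] exponents_UNIV] by simp
  qed (auto intro: Y_in_subalgebra)
  have A0: "Aj 0 = R" by (rule iterated_skew_poly_ringD(1)[OF iter])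
  note stab_R = stab[of 0, unfolded A0, simplified]
  \<comment> \<open>Since \<open>twist\<close> and \<open>lift\<close> refer only to the
    coefficients in \<open>Ahat\<close>, the same maps serve on \<open>B (i - 1)\<close> and on
    \<open>Bhat (i - 1)\<close>. The parameter is dictated by
    \<open>x i * y = scale (inverse (lam i)) (y * x i)\<close>.\<close>
  define \<tau>' where "\<tau>' i = twist (inverse (lam i)) (\<tau> i)" for i
  define \<delta>' where "\<delta>' i = lift (\<delta> i)" for i
  have lam: "lam i \<noteq> 0" "inverse (lam i) \<noteq> 0" "\<sigma> (x i) = scale (lam i) (x i)" if "i \<in> {1..n}" for i
    using x[OF that] by auto
  have stab_pred: "stable (Aj (i - 1))" and stab_i: "stable (Aj i)" if "i \<in> {1..n}" for i
    using that by (auto intro!: stab)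
  have aut: "algebra_automorphism_on scale (Aj (i - 1)) (\<tau> i)"
    and der: "skew_derivation_on scale (Aj (i - 1)) (\<tau> i) (\<delta> i)"
    and lin: "linear_operator_on scale (Aj (i - 1)) (\<delta> i)" if "i \<in> {1..n}" for i
    using skew_poly_ringD(2,3)[OF step[OF that]] by (auto simp: skew_derivation_on_def)
  have comm: "\<tau> i (\<sigma> a) = \<sigma> (\<tau> i a)" if "i \<in> {1..n}" "a \<in> Aj (i - 1)" for i a
    using skew_poly_ring_commutes(1)[OF step[OF that(1)] stableD(2)[OF stab_i[OF that(1)]]
        stableD(3)[OF stab_pred[OF that(1)]] lam(3,1)[OF that(1)] that(2)] .
  have one: "1 \<in> Aj (i - 1)" if "i \<in> {1..n}" for i
    by (rule subalgebraD(1)[OF stableD(1)[OF stab_pred[OF that]]])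
  have ring_step: "skew_poly_ring scale (part M (Aj (i - 1))) (x i) (\<tau>' i) (\<delta>' i) (part M (Aj i))"
    if "exponents M" "i \<in> {1..n}" for M i
    unfolding \<tau>'_def \<delta>'_def
    by (rule part_skew_poly_ring[OF step[OF that(2)] stab_pred[OF that(2)] stab_i[OF that(2)] that(1)
          lam(3,1)[OF that(2)]])
  have Bi: "B (i - 1) = part {0..} (Aj (i - 1))" "B i = part {0..} (Aj i)"
    "Bhat (i - 1) = part UNIV (Aj (i - 1))" "Bhat i = part UNIV (Aj i)" if "i \<in> {1..n}" for i
    using that by (auto intro!: B Bhat)
  have const: "\<tau>' i a = \<tau> i a" "\<delta>' i a = \<delta> i a" if i: "i \<in> {1..n}" and a: "a \<in> Aj (i - 1)" for i a
    using twist_const[OF stab_pred[OF i] exponents_UNIV lam(2)[OF i] aut[OF i] comm[OF i] a]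
      lift_const[OF stab_pred[OF i] exponents_UNIV lam(2)[OF i] aut[OF i] comm[OF i] lin[OF i] a]
    by (simp_all add: \<tau>'_def \<delta>'_def)
  have lift_y: "lift f y = f 1 * y" if "i \<in> {1..n}" "linear_operator_on scale (Aj (i - 1)) f" for f i
    using coeffwise_monomial[OF stab_pred[OF that(1)] that(2) one[OF that(1)], of 1]
    by (simp add: lift_def Y_1)
  have y: "\<tau>' i y = scale (inverse (lam i)) y" "\<delta>' i y = 0" if i: "i \<in> {1..n}" for i
  proof -
    show "\<tau>' i y = scale (inverse (lam i)) y"
      using twist_monomial[OF stab_pred[OF i] exponents_UNIV lam(2)[OF i] aut[OF i] comm[OF i] one[OF i], of 1]
      by (simp add: \<tau>'_def Y_1 automorphism_onD(3)[OF aut[OF i]] scale_mult_left[symmetric])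
    show "\<delta>' i y = 0"
      using lift_y[OF i lin[OF i]]
        skew_derivation_one[OF stableD(1)[OF stab_pred[OF i]] aut[OF i] der[OF i]]
      by (simp add: \<delta>'_def)
  qed
  have q_skew: "q_skew_on scale (part M (Aj (i - 1))) q (\<tau>' i) (\<delta>' i)"
    if i: "i \<in> {1..n}" and M: "exponents M" and q: "q_skew_on scale (Aj (i - 1)) q (\<tau> i) (\<delta> i)" for M i q
    unfolding \<tau>'_def \<delta>'_def
    by (rule lift_q_skew[OF stab_pred[OF i] M lam(2)[OF i] aut[OF i] comm[OF i] lin[OF i] q])
  have higher: "\<exists>d' :: nat \<Rightarrow> nat \<Rightarrow> 'a \<Rightarrow> 'a. \<forall>i\<in>{1..n}.
           higher_skew_derivation_on scale (Bhat (i - 1)) (q i) (\<tau>' i) (d' i) \<and>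
           extends_to_on (Bhat (i - 1)) (\<delta>' i) (d' i) \<and>
           (\<forall>p. \<forall>j<i. \<forall>a\<in>Aj j. d' i p a = d i p a) \<and>
           (\<forall>p\<ge>1. d' i p y = 0) \<and>
           higher_skew_derivation_on scale (B (i - 1)) (q i) (\<tau>' i) (d' i) \<and>
           (iterative_on scale (Aj (i - 1)) (q i) (d i) \<longrightarrow>
              iterative_on scale (Bhat (i - 1)) (q i) (d' i)) \<and>
           (locally_nilpotent_on (Aj (i - 1)) (d i) \<longrightarrow>
              locally_nilpotent_on (Bhat (i - 1)) (d' i))"
    if d: "\<forall>i\<in>{1..n}.
           higher_skew_derivation_on scale (Aj (i - 1)) (q i) (\<tau> i) (d i) \<and>
           extends_to_on (Aj (i - 1)) (\<delta> i) (d i) \<and>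
           (\<forall>p. \<forall>a\<in>Aj (i - 1). \<sigma> (d i p a) = scale (lam i ^ p) (d i p (\<sigma> a)))"
    for q :: "nat \<Rightarrow> 'k" and d :: "nat \<Rightarrow> nat \<Rightarrow> 'a \<Rightarrow> 'a"
  proof (rule exI[of _ "\<lambda>i p. lift (d i p)"], rule ballI)
    fix i assume i: "i \<in> {1..n}"
    from d i have h: "higher_skew_derivation_on scale (Aj (i - 1)) (q i) (\<tau> i) (d i)"
      and ext: "\<And>a. a \<in> Aj (i - 1) \<Longrightarrow> d i 1 a = \<delta> i a"
      and \<sigma>d: "\<And>p a. a \<in> Aj (i - 1) \<Longrightarrow> \<sigma> (d i p a) = scale (lam i ^ p) (d i p (\<sigma> a))"
      unfolding extends_to_on_def by blast+
    have d_lin: "linear_operator_on scale (Aj (i - 1)) (d i p)" for p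
      using h by (simp add: higher_skew_derivation_on_def)
    \<comment> \<open>The assumed rule is solved for \<open>d i p (\<sigma> a)\<close>; its scalar
      is then the p-th power of the parameter of \<open>\<tau>' i\<close>.\<close>
    have d\<sigma>: "d i p (\<sigma> a) = scale (inverse (lam i) ^ p) (\<sigma> (d i p a))" if "a \<in> Aj (i - 1)" for p a
      using lam(1)[OF i] by (simp add: \<sigma>d[OF that] power_inverse)
    have hi: "higher_skew_derivation_on scale (part M (Aj (i - 1))) (q i) (\<tau>' i) (\<lambda>p. lift (d i p))"
      if "exponents M" for M
      unfolding \<tau>'_def by (rule lift_higher_skew_derivation[OF stab_pred[OF i] that lam(2)[OF i] aut[OF i] comm[OF i] h d\<sigma>])
    \<comment> \<open>The operators \<open>d i 1\<close> and \<open>\<delta> i\<close> agree only on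
      \<open>Aj (i - 1)\<close>, so the extensions are compared through coefficients, which lie
      there.\<close>
    have "lift (d i 1) s = \<delta>' i s" if s: "s \<in> part UNIV (Aj (i - 1))" for s
      unfolding \<delta>'_def lift_def coeffwise_def
      by (rule sum.cong) (simp_all only: ext[OF part_cf[OF s]])
    moreover have "lift (d i p) a = d i p a" if "j < i" "a \<in> Aj j" for p j a
    proof (rule lift_const[OF stab_pred[OF i] exponents_UNIV lam(2)[OF i] aut[OF i] comm[OF i] d_lin])
      have j: "j \<le> i - 1" "i - 1 \<le> n" using that(1) i by auto
      show "a \<in> Aj (i - 1)"
        using iterated_skew_poly_ring_mono[OF iter _ j(2)] j(1) that(2) by blast
    qed
    moreover have "lift (d i p) y = 0" if "p \<ge> 1" for p
      using lift_y[OF i d_lin]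
        higher_skew_derivation_one[OF stableD(1)[OF stab_pred[OF i]] aut[OF i] h that] by simp
    ultimately show "higher_skew_derivation_on scale (Bhat (i - 1)) (q i) (\<tau>' i) (\<lambda>p. lift (d i p)) \<and>
           extends_to_on (Bhat (i - 1)) (\<delta>' i) (\<lambda>p. lift (d i p)) \<and>
           (\<forall>p. \<forall>j<i. \<forall>a\<in>Aj j. lift (d i p) a = d i p a) \<and>
           (\<forall>p\<ge>1. lift (d i p) y = 0) \<and>
           higher_skew_derivation_on scale (B (i - 1)) (q i) (\<tau>' i) (\<lambda>p. lift (d i p)) \<and>
           (iterative_on scale (Aj (i - 1)) (q i) (d i) \<longrightarrow>
              iterative_on scale (Bhat (i - 1)) (q i) (\<lambda>p. lift (d i p))) \<and>
           (locally_nilpotent_on (Aj (i - 1)) (d i) \<longrightarrow>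
              locally_nilpotent_on (Bhat (i - 1)) (\<lambda>p. lift (d i p)))"
      unfolding Bi[OF i] extends_to_on_def
      by (intro conjI impI allI ballI hi exponents_UNIV exponents_nonneg
          lift_iterative[OF stab_pred[OF i] exponents_UNIV lam(2)[OF i] aut[OF i] comm[OF i] d_lin]
          lift_locally_nilpotent[OF stab_pred[OF i] exponents_UNIV lam(2)[OF i] aut[OF i] comm[OF i] d_lin])
        blast+
  qed
  have "iterated_skew_poly_ring scale (B 0) n x \<tau>' \<delta>' B"
    unfolding iterated_skew_poly_ring_def
    using part_subalgebra[OF stab exponents_nonneg, of 0] ring_step[OF exponents_nonneg]
    by (auto simp: B)
  moreover have "iterated_skew_poly_ring scale (Bhat 0) n x \<tau>' \<delta>' Bhat"
    unfolding iterated_skew_poly_ring_def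
    using part_subalgebra[OF stab exponents_UNIV, of 0] ring_step[OF exponents_UNIV]
    by (auto simp: Bhat)
  moreover have "skew_poly_ring scale R y \<sigma> (\<lambda>_. 0) (B 0)"
    using part_skew_poly_ring_y[OF stab_R] by (simp add: B A0)
  moreover have "skew_laurent_ring scale R y yi \<sigma> (Bhat 0)"
    using part_skew_laurent_ring[OF stab_R] by (simp add: Bhat A0)
  moreover have "B n = A"
    using part_nonneg_N[OF A_skew] by (simp add: B)
  moreover have "Bhat n = Ahat"
    using part_UNIV_N by (simp add: Bhat)
  moreover have "\<tau>' i a = \<tau> i a \<and> \<delta>' i a = \<delta> i a" if "i \<in> {1..n}" "j \<le> i - 1" "a \<in> Aj j" for i j a
    using const[OF that(1)] iterated_skew_poly_ring_mono[OF iter that(2)] that by fastforce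
  ultimately show ?thesis
    using y q_skew[OF _ exponents_nonneg] q_skew[OF _ exponents_UNIV] higher
    by (intro exI[of _ \<tau>'] exI[of _ \<delta>']) (simp add: Bi del: One_nat_def)
qed

end
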